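(* Let $G = \langle a_1, a_2,\ldots \mid r_1, r_2,\ldots \rangle$ be any torsion-free countable group given by generators and defining relations. For each $s$ let $r''_s(x,y)\in F_2=\langle x,y\rangle$ be the word obtained from $r_s$ by replacing every generator $a_i$ occurring in $r_s$ by the word $$\bar a_i(x,y) = y^{(x y^i)^{2}\, x^{-1}}.$$ Then the map $\gamma: a_i \mapsto \bar a_i(x,y)$, $i=1,2,\ldots$, defines an injective embedding (injective group homomorphism) of $G$ into the $2$-generator group $$T_G=\big\langle x,y \;\mid\; r''_1(x,y),\; r''_2(x,y),\ldots \big\rangle$$ given by its relations $r''_s(x,y)$, $s=1,2,\ldots$
   Context: Conjugation notation: $u^v = v^{-1}uv$. $F_2=\langle x,y\rangle$ is the free group of rank $2$ on $x,y$. Thus, for $i=1,2,\ldots$, $\bar a_i(x,y) = w_i^{-1}\, y\, w_i$ with $w_i = (xy^i)^2x^{-1} = x y^i x y^i x^{-1}$. Each relation $r_s$ is a group word $r_s(a_{i_{s,1}},\ldots,a_{i_{s,k_s}})$ in finitely many of the letters $a_1,a_2,\ldots$ and their inverses, and $r''_s(x,y)= r_s\big(\bar a_{i_{s,1}}(x,y),\ldots,\bar a_{i_{s,k_s}}(x,y)\big)\in F_2$ (with $a_i^{-1}$ replaced by $\bar a_i(x,y)^{-1}$). The presentation has countably many generators $a_1,a_2,\ldots$ and countably many relations $r_1,r_2,\ldots$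
   Formalization: The formal theorem adds the assumption that if some listed generator a_i is trivial in G then G itself is trivial; without it the claim fails, since a relation such as a_2 forces y = 1 in T_G and kills every generator. *)

theory Defs
  imports "HOL-Algebra.Coset"
begin

text \<open>
  The libraries contain free abelian groups but neither free groups nor presentations, so these
  are built here: group words, the free group as words modulo cancellation, and
  \<open>\<langle>X | R\<rangle>\<close> as the quotient of the free group by the normal closure of \<open>R\<close>.
\<close>

section \<open>Group words\<close>

text \<open>The letter \<open>(a, True)\<close> stands for \<open>a\<close> and \<open>(a, False)\<close> for its formal inverse.\<close>

type_synonym 'a word = "('a \<times> bool) list"

definition words :: "'a set \<Rightarrow> 'a word set"
  where "words X = lists (X \<times> UNIV)"

definition letter :: "'a \<Rightarrow> 'a word"
  where "letter a = [(a, True)]"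

definition inv_word :: "'a word \<Rightarrow> 'a word"
  where "inv_word w = rev (map (\<lambda>(a, b). (a, \<not> b)) w)"

definition pow_word :: "'a word \<Rightarrow> nat \<Rightarrow> 'a word"
  where "pow_word w n = concat (replicate n w)"

text \<open>\<open>u\<^sup>v = v\<inverse> u v\<close>\<close>

definition conj_word :: "'a word \<Rightarrow> 'a word \<Rightarrow> 'a word"
  where "conj_word u v = inv_word v @ u @ v"

definition subst_word :: "('a \<Rightarrow> 'b word) \<Rightarrow> 'a word \<Rightarrow> 'b word"
  where "subst_word f w = concat (map (\<lambda>(a, b). if b then f a else inv_word (f a)) w)"

section \<open>Free groups and presentations\<close>

inductive_set free_eq :: "'a set \<Rightarrow> ('a word \<times> 'a word) set" for X :: "'a set"
  where
    refl: "w \<in> words X \<Longrightarrow> (w, w) \<in> free_eq X"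
  | sym: "(u, v) \<in> free_eq X \<Longrightarrow> (v, u) \<in> free_eq X"
  | trans: "(u, v) \<in> free_eq X \<Longrightarrow> (v, w) \<in> free_eq X \<Longrightarrow> (u, w) \<in> free_eq X"
  | cancel: "u \<in> words X \<Longrightarrow> v \<in> words X \<Longrightarrow> a \<in> X \<Longrightarrow>
      (u @ [(a, b), (a, \<not> b)] @ v, u @ v) \<in> free_eq X"

definition free_elem :: "'a set \<Rightarrow> 'a word \<Rightarrow> 'a word set"
  where "free_elem X w = free_eq X `` {w}"

definition free_group :: "'a set \<Rightarrow> 'a word set monoid"
  where "free_group X =
    \<lparr>carrier = words X // free_eq X,
     mult = (\<lambda>A B. \<Union>u\<in>A. \<Union>v\<in>B. free_elem X (u @ v)),
     one = free_elem X []\<rparr>"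

definition normal_closure :: "('a, 'b) monoid_scheme \<Rightarrow> 'a set \<Rightarrow> 'a set"
  where "normal_closure G S = \<Inter> {N. N \<lhd> G \<and> S \<subseteq> N}"

definition relator_subgroup :: "'a set \<Rightarrow> 'a word set \<Rightarrow> 'a word set set"
  where "relator_subgroup X R = normal_closure (free_group X) (free_elem X ` R)"

definition presented_group :: "'a set \<Rightarrow> 'a word set \<Rightarrow> 'a word set set monoid"
  where "presented_group X R = free_group X Mod relator_subgroup X R"

text \<open>The element of \<open>\<langle>X | R\<rangle>\<close> represented by the word \<open>w\<close>.\<close>

definition pres_elem :: "'a set \<Rightarrow> 'a word set \<Rightarrow> 'a word \<Rightarrow> 'a word set set"
  where "pres_elem X R w = relator_subgroup X R #>\<^bsub>free_group X\<^esub> free_elem X w"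

definition torsion_free :: "('a, 'b) monoid_scheme \<Rightarrow> bool"
  where "torsion_free G \<longleftrightarrow>
    (\<forall>g\<in>carrier G. g \<noteq> \<one>\<^bsub>G\<^esub> \<longrightarrow> (\<forall>n::nat. n > 0 \<longrightarrow> g [^]\<^bsub>G\<^esub> n \<noteq> \<one>\<^bsub>G\<^esub>))"

text \<open>
  Index sets of lists \<open>a\<^sub>1, a\<^sub>2, \<dots>\<close> numbered from \<open>1\<close>, infinite or finite.
\<close>

definition list_indices :: "nat set \<Rightarrow> bool"
  where "list_indices I \<longleftrightarrow> I = {1..} \<or> (\<exists>n. I = {1..n})"

section \<open>The words in two letters\<close>

datatype xy = X_gen | Y_gen

abbreviation x_word :: "xy word"
  where "x_word \<equiv> letter X_gen"

abbreviation y_word :: "xy word"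
  where "y_word \<equiv> letter Y_gen"

definition a_bar :: "nat \<Rightarrow> xy word"
  where "a_bar i = conj_word y_word (pow_word (x_word @ pow_word y_word i) 2 @ inv_word x_word)"

text \<open>
  All words \<open>a_bar i\<close> represent conjugates of \<open>y\<close>. Hence if one generator \<open>a\<^sub>i\<close> is trivial in \<open>G\<close>, then
  a homomorphism with \<open>a\<^sub>i \<mapsto> a_bar i\<close> forces \<open>y = 1\<close> in the target, so it kills every generator, and it is
  injective only if \<open>G\<close> is trivial. The embedding theorem therefore needs the hypothesis that a
  nontrivial \<open>G\<close> has no trivial generator among the \<open>a\<^sub>i\<close>.
\<close>

section \<open>The structures above are groups\<close>

lemma words_append [simp]: "u @ v \<in> words X \<longleftrightarrow> u \<in> words X \<and> v \<in> words X"
  by (auto simp: words_def)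

lemma words_Nil [simp]: "[] \<in> words X"
  by (simp add: words_def)

lemma words_inv_word [simp]: "w \<in> words X \<Longrightarrow> inv_word w \<in> words X"
  by (auto simp: words_def inv_word_def in_lists_conv_set)

lemma free_eq_words: "(u, v) \<in> free_eq X \<Longrightarrow> u \<in> words X \<and> v \<in> words X"
  by (induction rule: free_eq.induct) (auto simp: words_def)

lemma equiv_free_eq: "equiv (words X) (free_eq X)"
proof (rule equivI)
  show "free_eq X \<subseteq> words X \<times> words X" using free_eq_words by auto
  show "refl_on (words X) (free_eq X)"
    by (auto simp: refl_on_def intro: free_eq.refl)
  show "sym (free_eq X)" by (auto intro: symI free_eq.sym)
  show "trans (free_eq X)" by (auto intro: transI free_eq.trans)
qed

lemma free_eq_append_left:
  "(u, v) \<in> free_eq X \<Longrightarrow> w \<in> words X \<Longrightarrow> (w @ u, w @ v) \<in> free_eq X"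
proof (induction rule: free_eq.induct)
  case (cancel u v a b)
  then show ?case using free_eq.cancel[of "w @ u" X v a b] by simp
qed (auto intro: free_eq.intros)

lemma free_eq_append_right:
  "(u, v) \<in> free_eq X \<Longrightarrow> w \<in> words X \<Longrightarrow> (u @ w, v @ w) \<in> free_eq X"
proof (induction rule: free_eq.induct)
  case (cancel u v a b)
  then show ?case using free_eq.cancel[of u X "v @ w" a b] by simp
qed (auto intro: free_eq.intros)

lemma free_eq_append:
  "(u, u') \<in> free_eq X \<Longrightarrow> (v, v') \<in> free_eq X \<Longrightarrow> (u @ v, u' @ v') \<in> free_eq X"
  by (meson free_eq.trans free_eq_append_left free_eq_append_right free_eq_words)

lemma free_elem_eqI: "(u, v) \<in> free_eq X \<Longrightarrow> free_elem X u = free_elem X v"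
  unfolding free_elem_def by (rule equiv_class_eq[OF equiv_free_eq])

lemma free_eq_inv_left: "w \<in> words X \<Longrightarrow> (inv_word w @ w, []) \<in> free_eq X"
proof (induction w)
  case Nil
  then show ?case by (auto simp: inv_word_def intro: free_eq.refl)
next
  case (Cons c w)
  obtain a b where c: "c = (a, b)" by (cases c)
  have w: "w \<in> words X" and a: "a \<in> X"
    using Cons.prems by (auto simp: words_def c)
  have "(inv_word w @ [(a, \<not> b), (a, \<not> \<not> b)] @ w, inv_word w @ w) \<in> free_eq X"
    by (rule free_eq.cancel) (use w a in auto)
  with Cons.IH[OF w] show ?case by (auto simp: inv_word_def c intro: free_eq.trans)
qed

lemma carrier_free_group: "carrier (free_group X) = free_elem X ` words X"
  by (auto simp: free_group_def free_elem_def quotient_def)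

lemma one_free_group: "\<one>\<^bsub>free_group X\<^esub> = free_elem X []"
  by (simp add: free_group_def)

lemma mult_free_group:
  assumes "u \<in> words X" "v \<in> words X"
  shows "free_elem X u \<otimes>\<^bsub>free_group X\<^esub> free_elem X v = free_elem X (u @ v)"
proof -
  have eq: "free_elem X (u' @ v') = free_elem X (u @ v)"
    if "u' \<in> free_elem X u" "v' \<in> free_elem X v" for u' v'
  proof -
    have "(u @ v, u' @ v') \<in> free_eq X"
      using that by (intro free_eq_append) (simp_all add: free_elem_def)
    then show ?thesis by (rule free_elem_eqI[symmetric])
  qed
  have ne: "free_elem X u \<noteq> {}" "free_elem X v \<noteq> {}"
    using assms free_eq.refl by (auto simp: free_elem_def)
  have "(\<Union>u'\<in>free_elem X u. \<Union>v'\<in>free_elem X v. free_elem X (u' @ v'))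
      = (\<Union>u'\<in>free_elem X u. \<Union>v'\<in>free_elem X v. free_elem X (u @ v))"
    using eq by (intro SUP_cong HOL.refl)
  then show ?thesis
    using ne by (simp add: free_group_def)
qed

lemma group_free_group: "group (free_group X)"
proof (rule groupI)
  fix A B assume "A \<in> carrier (free_group X)" "B \<in> carrier (free_group X)"
  then show "A \<otimes>\<^bsub>free_group X\<^esub> B \<in> carrier (free_group X)"
    by (auto simp: carrier_free_group mult_free_group)
next
  show "\<one>\<^bsub>free_group X\<^esub> \<in> carrier (free_group X)"
    by (auto simp: carrier_free_group one_free_group)
next
  fix A B C
  assume "A \<in> carrier (free_group X)" "B \<in> carrier (free_group X)" "C \<in> carrier (free_group X)"
  then show "A \<otimes>\<^bsub>free_group X\<^esub> B \<otimes>\<^bsub>free_group X\<^esub> C = A \<otimes>\<^bsub>free_group X\<^esub> (B \<otimes>\<^bsub>free_group X\<^esub> C)"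
    by (auto simp: carrier_free_group mult_free_group)
next
  fix A assume "A \<in> carrier (free_group X)"
  then obtain w where w: "w \<in> words X" "A = free_elem X w"
    by (auto simp: carrier_free_group)
  then show "\<one>\<^bsub>free_group X\<^esub> \<otimes>\<^bsub>free_group X\<^esub> A = A"
    by (auto simp: one_free_group mult_free_group)
  have "free_elem X (inv_word w) \<otimes>\<^bsub>free_group X\<^esub> A = \<one>\<^bsub>free_group X\<^esub>"
    using w by (simp add: one_free_group mult_free_group free_elem_eqI free_eq_inv_left)
  then show "\<exists>B\<in>carrier (free_group X). B \<otimes>\<^bsub>free_group X\<^esub> A = \<one>\<^bsub>free_group X\<^esub>"
    using w by (auto simp: carrier_free_group)
qed

lemma (in group) normal_closure_normal:
  assumes "S \<subseteq> carrier G"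
  shows "normal_closure G S \<lhd> G"
proof -
  have "carrier G \<lhd> G"
    by (rule normal_invI[OF subgroup_self]) simp
  then have "carrier G \<in> {N. N \<lhd> G \<and> S \<subseteq> N}" using assms by simp
  moreover have "subgroup (normal_closure G S) G"
    unfolding normal_closure_def
    by (rule subgroups_Inter) (use calculation in \<open>auto simp: normal_imp_subgroup\<close>)
  ultimately show ?thesis
    by (auto simp: normal_inv_iff normal_closure_def)
qed

lemma group_presented_group:
  assumes "R \<subseteq> words X"
  shows "group (presented_group X R)"
proof -
  interpret F: group "free_group X" by (rule group_free_group)
  have "free_elem X ` R \<subseteq> carrier (free_group X)"
    using assms by (auto simp: carrier_free_group)
  then show ?thesis
    unfolding presented_group_def relator_subgroup_def
    by (intro normal.factorgroup_is_group F.normal_closure_normal)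
qed

end

(*
  The map \<open>a\<^sub>i \<mapsto> a_bar i\<close> is a homomorphism by construction, so it suffices to find one group that contains
  \<open>G\<close> and elements \<open>x\<close>, \<open>y\<close> with \<open>a\<^sub>i = a_bar i (x, y)\<close>. If \<open>x\<close> conjugates \<open>y\<close> to \<open>b\<close> and \<open>b\<close> to \<open>e\<close>, then
  \<open>a_bar i (x, y)\<close> is the conjugate by \<open>x\<inverse>\<close> of \<open>e^(b^i y^i)\<close>. Hence one needs \<open>b\<close>, \<open>y\<close>, \<open>e\<close> in a
  group containing \<open>G\<close> such that \<open>e^(b^i y^i) = a\<^sub>i\<close> and both \<open>(y, b)\<close> and \<open>(b, e)\<close> freely generate free
  groups; an HNN extension then provides \<open>x\<close>.

  The groups are realized by permutations of countable sets. In the regular representation all elements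
  of infinite order are conjugate, which gives \<open>s\<^sub>i\<close> with \<open>e^(s\<^sub>i) = a\<^sub>i\<close>. Making \<open>b^i y^i\<close> act as \<open>s\<^sub>i\<close>
  amounts to an amalgamated product over the free group on the \<open>b^i y^i\<close>; it is built by gluing a set
  with an action of \<open>b, y\<close> to a set with an action of \<open>e, s\<^sub>i, G\<close> along an equivariant bijection, chosen
  so that \<open>b\<close> and \<open>e\<close> play ping-pong.
*)
theory Submission
  imports Defs "HOL-Algebra.Generated_Groups" "HOL-Library.Countable_Set"
begin

section \<open>Values of words in a group\<close>

fun word_val :: "('k, 'm) monoid_scheme \<Rightarrow> ('a \<Rightarrow> 'k) \<Rightarrow> 'a word \<Rightarrow> 'k"
  where
    "word_val K f [] = \<one>\<^bsub>K\<^esub>"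
  | "word_val K f ((a, b) # w) = (if b then f a else inv\<^bsub>K\<^esub> f a) \<otimes>\<^bsub>K\<^esub> word_val K f w"

lemma words_UNIV [simp]: "words UNIV = UNIV"
  by (auto simp: words_def)

lemma words_Cons [simp]: "(a, b) # w \<in> words X \<longleftrightarrow> a \<in> X \<and> w \<in> words X"
  by (auto simp: words_def)

lemma inv_word_Nil [simp]: "inv_word [] = []"
  by (simp add: inv_word_def)

lemma inv_word_Cons [simp]: "inv_word ((a, b) # w) = inv_word w @ [(a, \<not> b)]"
  by (simp add: inv_word_def)

lemma inv_word_append [simp]: "inv_word (u @ v) = inv_word v @ inv_word u"
  by (simp add: inv_word_def)

lemma subst_word_Nil [simp]: "subst_word f [] = []"
  by (simp add: subst_word_def)

lemma subst_word_Cons [simp]: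
  "subst_word f ((a, b) # w) = (if b then f a else inv_word (f a)) @ subst_word f w"
  by (simp add: subst_word_def)

lemma subst_word_append [simp]: "subst_word f (u @ v) = subst_word f u @ subst_word f v"
  by (simp add: subst_word_def)

lemma subst_word_words:
  assumes "w \<in> words Z" "\<And>a. a \<in> Z \<Longrightarrow> f a \<in> words X"
  shows "subst_word f w \<in> words X"
  using assms(1)
proof (induction w)
  case (Cons c w)
  then show ?case using assms(2) by (cases c) auto
qed simp

lemma (in group) word_val_closed [simp]:
  assumes f: "\<And>a. f a \<in> carrier G"
  shows "word_val G f w \<in> carrier G"
  by (induction w) (auto simp: f)

lemma (in group) word_val_append:
  assumes f: "\<And>a. f a \<in> carrier G"
  shows "word_val G f (u @ v) = word_val G f u \<otimes> word_val G f v"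
  by (induction u) (auto simp: f m_assoc)

lemma (in group) word_val_inv_word:
  assumes f: "\<And>a. f a \<in> carrier G"
  shows "word_val G f (inv_word w) = inv (word_val G f w)"
  by (induction w) (auto simp: f word_val_append inv_mult_group)

lemma (in group) word_val_letter:
  assumes f: "\<And>a. f a \<in> carrier G"
  shows "word_val G f (letter a) = f a"
  by (simp add: letter_def f)

lemma (in group) word_val_pow_word:
  assumes f: "\<And>a. f a \<in> carrier G"
  shows "word_val G f (pow_word w n) = word_val G f w [^] n"
proof (induction n)
  case (Suc n)
  then show ?case
    using nat_pow_Suc2[of "word_val G f w" n] by (simp add: f pow_word_def word_val_append)
qed (simp add: pow_word_def)

lemma (in group) word_val_subst_word:
  assumes f: "\<And>a. f a \<in> carrier G"
  shows "word_val G f (subst_word h w) = word_val G (\<lambda>a. word_val G f (h a)) w"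
  by (induction w) (auto simp: f word_val_append word_val_inv_word)

lemma (in group) word_val_free_eq:
  assumes f: "\<And>a. f a \<in> carrier G" and uv: "(u, v) \<in> free_eq X"
  shows "word_val G f u = word_val G f v"
  using uv
proof (induction rule: free_eq.induct)
  case (cancel u v a b)
  have "f a \<otimes> (inv f a \<otimes> g) = g" "inv f a \<otimes> (f a \<otimes> g) = g" if "g \<in> carrier G" for g
    using that f[of a] by (simp_all flip: m_assoc)
  then show ?case
    by (cases b) (simp_all add: word_val_append f)
qed auto

lemma (in group) word_val_cong:
  assumes "w \<in> words X" "\<And>a. a \<in> X \<Longrightarrow> f a = g a"
  shows "word_val G f w = word_val G g w"
  using assms by (induction w) auto

lemma (in group) word_val_hom:
  assumes "group H" "\<phi> \<in> hom G H" and f: "\<And>a. f a \<in> carrier G"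
  shows "\<phi> (word_val G f w) = word_val H (\<lambda>a. \<phi> (f a)) w"
proof -
  have closed: "word_val G f w \<in> carrier G" for w
    by (simp add: f)
  interpret group_hom G H \<phi>
    using assms by (simp add: group_hom_def group_hom_axioms_def is_group)
  show ?thesis
    by (induction w) (auto simp: f closed)
qed

lemma (in group) word_val_subgroup:
  assumes "subgroup H G" "\<And>a. f a \<in> H"
  shows "word_val (G\<lparr>carrier := H\<rparr>) f w = word_val G f w"
  using assms by (induction w) (auto simp: m_inv_consistent)

lemma (in group) countable_generate:
  assumes "countable S" "S \<subseteq> carrier G"
  shows "countable (generate G S)"
proof -
  define f where "f a = (if a \<in> S then a else \<one>)" for a
  have f: "f a \<in> carrier G" for a using assms by (auto simp: f_def)
  have "\<exists>w\<in>words S. g = word_val G f w" if "g \<in> generate G S" for g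
    using that
  proof induction
    case one
    then show ?case by (rule bexI[of _ "[]"]) auto
  next
    case (incl h)
    then show ?case using f[of h] by (intro bexI[of _ "[(h, True)]"]) (auto simp: f_def)
  next
    case (inv h)
    then show ?case using f[of h] by (intro bexI[of _ "[(h, False)]"]) (auto simp: f_def)
  next
    case (eng g h)
    then obtain u v where "u \<in> words S" "v \<in> words S" "g = word_val G f u" "h = word_val G f v"
      by auto
    then show ?case by (intro bexI[of _ "u @ v"]) (auto simp: word_val_append f)
  qed
  then have "generate G S \<subseteq> word_val G f ` words S" by auto
  moreover have "countable (words S)"
    unfolding words_def using assms by (intro countable_lists) auto
  ultimately show ?thesis
    by (meson countable_image countable_subset)
qed

section \<open>Homomorphisms from presented groups\<close>

lemma word_val_free_group:
  "word_val (free_group UNIV) (\<lambda>a. free_elem UNIV (letter a)) w = free_elem UNIV w"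
proof (induction w)
  case (Cons c w)
  interpret F: group "free_group (UNIV :: 'a set)" by (rule group_free_group)
  obtain a b where c: "c = (a, b)" by (cases c)
  have el: "free_elem UNIV u \<in> carrier (free_group UNIV)" for u :: "'a word"
    by (simp add: carrier_free_group)
  have "free_elem UNIV [(a, False)] \<otimes>\<^bsub>free_group UNIV\<^esub> free_elem UNIV (letter a) = \<one>\<^bsub>free_group UNIV\<^esub>"
    using free_eq_inv_left[of "letter a" UNIV]
    by (simp add: mult_free_group one_free_group letter_def free_elem_eqI)
  then have "inv\<^bsub>free_group UNIV\<^esub> free_elem UNIV (letter a) = free_elem UNIV [(a, False)]"
    by (intro F.inv_equality el)
  then show ?case
    using Cons.IH by (auto simp: c mult_free_group letter_def)
qed (simp add: one_free_group)

lemma free_elem_eqD: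
  assumes "free_elem X u = free_elem X v" "v \<in> words X"
  shows "(u, v) \<in> free_eq X"
  using assms by (auto simp: free_elem_def intro: free_eq.refl)

lemma countable_free_group: "countable (carrier (free_group (X :: 'a :: countable set)))"
  by (simp add: carrier_free_group)

context
  fixes X :: "'a set" and R :: "'a word set"
  assumes R: "R \<subseteq> words X"
begin

lemma relator_subgroup_normal: "relator_subgroup X R \<lhd> free_group X"
  unfolding relator_subgroup_def using R
  by (intro group.normal_closure_normal group_free_group) (auto simp: carrier_free_group)

lemma carrier_presented_group: "carrier (presented_group X R) = pres_elem X R ` words X"
  by (auto simp: presented_group_def FactGroup_def RCOSETS_def pres_elem_def carrier_free_group)

lemma pres_elem_closed [simp]: "w \<in> words X \<Longrightarrow> pres_elem X R w \<in> carrier (presented_group X R)"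
  by (simp add: carrier_presented_group)

lemma mult_presented_group:
  assumes "u \<in> words X" "v \<in> words X"
  shows "pres_elem X R u \<otimes>\<^bsub>presented_group X R\<^esub> pres_elem X R v = pres_elem X R (u @ v)"
  using normal.rcos_sum[OF relator_subgroup_normal, of "free_elem X u" "free_elem X v"] assms
  by (simp add: presented_group_def FactGroup_def pres_elem_def carrier_free_group mult_free_group)

lemma one_presented_group: "\<one>\<^bsub>presented_group X R\<^esub> = pres_elem X R []"
proof -
  interpret F: group "free_group X" by (rule group_free_group)
  interpret N: normal "relator_subgroup X R" "free_group X" by (rule relator_subgroup_normal)
  show ?thesis
    using F.coset_mult_one[OF N.subset]
    by (simp add: presented_group_def FactGroup_def pres_elem_def one_free_group)
qed

lemma pres_elem_inv_word:
  assumes "w \<in> words X"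
  shows "inv\<^bsub>presented_group X R\<^esub> pres_elem X R w = pres_elem X R (inv_word w)"
proof -
  interpret P: group "presented_group X R" by (rule group_presented_group[OF R])
  have "free_elem X (inv_word w @ w) = free_elem X []"
    using assms by (intro free_elem_eqI free_eq_inv_left)
  then have "pres_elem X R (inv_word w @ w) = pres_elem X R []"
    by (simp add: pres_elem_def)
  then show ?thesis
    using assms by (intro P.inv_equality) (auto simp: mult_presented_group one_presented_group)
qed

lemma pres_elem_relator:
  assumes "w \<in> R"
  shows "pres_elem X R w = \<one>\<^bsub>presented_group X R\<^esub>"
proof -
  interpret F: group "free_group X" by (rule group_free_group)
  interpret N: normal "relator_subgroup X R" "free_group X" by (rule relator_subgroup_normal)
  have "free_elem X w \<in> relator_subgroup X R"
    using assms by (auto simp: relator_subgroup_def normal_closure_def)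
  then show ?thesis
    by (simp add: presented_group_def FactGroup_def pres_elem_def N.rcos_const)
qed

lemma word_val_presented_group:
  assumes "w \<in> words Z" "\<And>a. a \<in> Z \<Longrightarrow> f a \<in> words X"
  shows "word_val (presented_group X R) (\<lambda>a. pres_elem X R (f a)) w = pres_elem X R (subst_word f w)"
  using assms(1)
proof (induction w)
  case (Cons c w)
  obtain a b where c: "c = (a, b)" by (cases c)
  have w: "a \<in> Z" "w \<in> words Z" using Cons.prems by (auto simp: c)
  have "subst_word f w \<in> words X" using w(2) assms(2) by (rule subst_word_words)
  then show ?case
    using Cons.IH w assms(2) by (auto simp: c mult_presented_group pres_elem_inv_word)
qed (simp add: one_presented_group)

lemma pres_elem_eq_imp_word_val_eq:
  assumes K: "group K" and f: "\<And>a. f a \<in> carrier K"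
    and rel: "\<And>w. w \<in> R \<Longrightarrow> word_val K f w = \<one>\<^bsub>K\<^esub>"
    and w: "u \<in> words X" "v \<in> words X" and eq: "pres_elem X R u = pres_elem X R v"
  shows "word_val K f u = word_val K f v"
proof -
  interpret K: group K by fact
  let ?F = "free_group X"
  interpret F: group ?F by (rule group_free_group)
  interpret N: normal "relator_subgroup X R" ?F by (rule relator_subgroup_normal)
  define \<phi> where "\<phi> A = word_val K f (SOME w. w \<in> words X \<and> free_elem X w = A)" for A
  have \<phi>: "\<phi> (free_elem X w) = word_val K f w" if "w \<in> words X" for w
  proof -
    let ?v = "SOME v. v \<in> words X \<and> free_elem X v = free_elem X w"
    have "?v \<in> words X \<and> free_elem X ?v = free_elem X w"
      by (rule someI[of _ w]) (simp add: that)
    then have "(?v, w) \<in> free_eq X" using that by (intro free_elem_eqD) auto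
    then show ?thesis unfolding \<phi>_def by (rule K.word_val_free_eq[OF f])
  qed
  have "\<phi> \<in> hom ?F K"
    by (auto simp: hom_def carrier_free_group mult_free_group \<phi> f K.word_val_append)
  then interpret \<phi>: group_hom ?F K \<phi>
    by (simp add: group_hom_def group_hom_axioms_def K.is_group F.is_group)
  have "free_elem X ` R \<subseteq> kernel ?F K \<phi>"
    using R rel by (auto simp: kernel_def carrier_free_group \<phi> subset_iff)
  then have "relator_subgroup X R \<subseteq> kernel ?F K \<phi>"
    unfolding relator_subgroup_def normal_closure_def using \<phi>.normal_kernel by blast
  moreover have "free_elem X u \<in> relator_subgroup X R #>\<^bsub>?F\<^esub> free_elem X v"
    using eq F.rcos_self[OF _ N.subgroup_axioms, of "free_elem X u"] w
    by (simp add: pres_elem_def carrier_free_group)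
  ultimately obtain n where "n \<in> kernel ?F K \<phi>" "free_elem X u = n \<otimes>\<^bsub>?F\<^esub> free_elem X v"
    by (auto simp: r_coset_def)
  then have "\<phi> (free_elem X u) = \<phi> (free_elem X v)"
    using w by (simp add: kernel_def carrier_free_group)
  then show ?thesis using w by (simp add: \<phi>)
qed

lemma presented_group_hom:
  assumes K: "group K" and f: "\<And>a. f a \<in> carrier K"
    and rel: "\<And>w. w \<in> R \<Longrightarrow> word_val K f w = \<one>\<^bsub>K\<^esub>"
  shows "\<exists>h\<in>hom (presented_group X R) K. \<forall>w\<in>words X. h (pres_elem X R w) = word_val K f w"
proof -
  interpret K: group K by fact
  define h where "h A = word_val K f (SOME w. w \<in> words X \<and> pres_elem X R w = A)" for A
  have h: "h (pres_elem X R w) = word_val K f w" if "w \<in> words X" for w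
  proof -
    let ?v = "SOME v. v \<in> words X \<and> pres_elem X R v = pres_elem X R w"
    have "?v \<in> words X \<and> pres_elem X R ?v = pres_elem X R w"
      by (rule someI[of _ w]) (simp add: that)
    then show ?thesis
      unfolding h_def using that by (intro pres_elem_eq_imp_word_val_eq[OF K f rel]) auto
  qed
  have "h \<in> hom (presented_group X R) K"
    by (auto simp: hom_def carrier_presented_group mult_presented_group h f K.word_val_append)
  then show ?thesis using h by blast
qed

end

section \<open>Permutation groups\<close>

definition perm_group :: "('a \<Rightarrow> 'a) monoid"
  where "perm_group = \<lparr>carrier = {f. bij f}, mult = (\<circ>), one = id\<rparr>"

lemma perm_group_simps [simp]:
  "f \<in> carrier perm_group \<longleftrightarrow> bij f"
  "f \<otimes>\<^bsub>perm_group\<^esub> g = f \<circ> g"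
  "\<one>\<^bsub>perm_group\<^esub> = id"
  by (simp_all add: perm_group_def)

lemma group_perm_group: "group perm_group"
proof (rule groupI)
  fix f :: "'a \<Rightarrow> 'a" assume "f \<in> carrier perm_group"
  then show "\<exists>g\<in>carrier perm_group. g \<otimes>\<^bsub>perm_group\<^esub> f = \<one>\<^bsub>perm_group\<^esub>"
    by (intro bexI[of _ "inv_into UNIV f"]) (simp_all add: bij_is_inj bij_imp_bij_inv)
qed (auto simp: bij_comp)

interpretation perm_group: group perm_group
  by (rule group_perm_group)

lemma inv_perm_group [simp]: "bij f \<Longrightarrow> inv\<^bsub>perm_group\<^esub> f = inv_into UNIV f"
  by (rule perm_group.inv_equality) (simp_all add: bij_is_inj bij_imp_bij_inv)

lemma pow_perm_group: "f [^]\<^bsub>perm_group\<^esub> (n :: nat) = f ^^ n"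
  by (induction n) (simp_all add: funpow_swap1 fun_eq_iff)

abbreviation perm_val :: "('i \<Rightarrow> 'x \<Rightarrow> 'x) \<Rightarrow> 'i word \<Rightarrow> 'x \<Rightarrow> 'x"
  where "perm_val \<equiv> word_val perm_group"

context
  fixes t :: "'i \<Rightarrow> 'x \<Rightarrow> 'x"
  assumes t: "\<And>i. bij (t i)"
begin

lemma bij_perm_val: "bij (perm_val t w)"
  using perm_group.word_val_closed[of t w] t by simp

lemma perm_val_append: "perm_val t (u @ v) x = perm_val t u (perm_val t v x)"
  using perm_group.word_val_append[of t u v] t by simp

lemma perm_val_inv_word: "perm_val t (inv_word w) = inv_into UNIV (perm_val t w)"
  using perm_group.word_val_inv_word[of t w] t bij_perm_val by simp

lemma perm_val_invariant:
  assumes "\<And>i. t i ` X = X" "x \<in> X"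
  shows "perm_val t w x \<in> X"
proof (induction w)
  case (Cons c w)
  obtain a b where c: "c = (a, b)" by (cases c)
  have "inv_into UNIV (t a) ` X = X"
    using assms(1)[of a] t[of a] by (metis bij_is_inj image_inv_f_f)
  with Cons assms t show ?case by (auto simp: c)
qed (use assms in auto)

lemma perm_val_eq_iff: "perm_val t u x = perm_val t v x \<longleftrightarrow> perm_val t (inv_word v @ u) x = x"
proof -
  have "perm_val t (inv_word v @ u) x = inv_into UNIV (perm_val t v) (perm_val t u x)"
    by (simp add: perm_val_append perm_val_inv_word)
  then show ?thesis
    using bij_inv_eq_iff[OF bij_perm_val, of x v "perm_val t u x"] by metis
qed

end

lemma perm_val_free_eq_iff:
  assumes "\<And>i. bij (t i)" "\<And>w z. perm_val t w z = z \<Longrightarrow> (w, []) \<in> free_eq UNIV"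
  shows "perm_val t w z = z \<longleftrightarrow> (w, []) \<in> free_eq UNIV"
  using assms(2)[of w z] perm_group.word_val_free_eq[of t w "[]" UNIV] assms(1) by auto

text \<open>The factor \<open>nat\<close> makes the numbers of orbits equal.\<close>

lemma equivariant_bij:
  fixes t :: "'i \<Rightarrow> 'x \<Rightarrow> 'x" and t' :: "'i \<Rightarrow> 'y \<Rightarrow> 'y"
  assumes t: "\<And>i. bij (t i)" and t': "\<And>i. bij (t' i)"
    and X: "\<And>i. t i ` X = X" "countable X" "X \<noteq> {}"
    and Y: "\<And>i. t' i ` Y = Y" "countable Y" "Y \<noteq> {}"
    and stab: "\<And>w x y. x \<in> X \<Longrightarrow> y \<in> Y \<Longrightarrow> perm_val t w x = x \<longleftrightarrow> perm_val t' w y = y"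
  shows "\<exists>\<theta>. bij_betw \<theta> (X \<times> (UNIV :: nat set)) (Y \<times> (UNIV :: nat set)) \<and>
    (\<forall>i. \<forall>p\<in>X \<times> UNIV. \<theta> (apfst (t i) p) = apfst (t' i) (\<theta> p))"
proof -
  define r where "r x = (SOME z. z \<in> X \<and> (\<exists>w. perm_val t w z = x))" for x
  define r' where "r' x = (SOME z. z \<in> Y \<and> (\<exists>w. perm_val t' w z = x))" for x
  have r: "r x \<in> X \<and> (\<exists>w. perm_val t w (r x) = x)" if "x \<in> X" for x
    unfolding r_def by (rule someI_ex) (use that in \<open>auto intro!: exI[of _ x] exI[of _ "[]"]\<close>)
  have r': "r' x \<in> Y \<and> (\<exists>w. perm_val t' w (r' x) = x)" if "x \<in> Y" for x
    unfolding r'_def by (rule someI_ex) (use that in \<open>auto intro!: exI[of _ x] exI[of _ "[]"]\<close>)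
  have r_val: "r (perm_val t w x) = r x" for w x
  proof -
    have "(\<exists>v. perm_val t v z = perm_val t w x) \<longleftrightarrow> (\<exists>v. perm_val t v z = x)" for z
    proof safe
      fix v assume "perm_val t v z = perm_val t w x"
      then have "perm_val t (inv_word w @ v) z = x"
        using bij_perm_val[of t w] t
        by (simp add: perm_val_append perm_val_inv_word inv_f_f bij_is_inj)
      then show "\<exists>v. perm_val t v z = x" by blast
    next
      fix v show "\<exists>u. perm_val t u z = perm_val t w (perm_val t v z)"
        by (rule exI[of _ "w @ v"]) (simp add: perm_val_append t)
    qed
    then show ?thesis by (simp add: r_def)
  qed
  have r'_val: "r' (perm_val t' w x) = r' x" for w x
  proof -
    have "(\<exists>v. perm_val t' v z = perm_val t' w x) \<longleftrightarrow> (\<exists>v. perm_val t' v z = x)" for z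
    proof safe
      fix v assume "perm_val t' v z = perm_val t' w x"
      then have "perm_val t' (inv_word w @ v) z = x"
        using bij_perm_val[of t' w] t'
        by (simp add: perm_val_append perm_val_inv_word inv_f_f bij_is_inj)
      then show "\<exists>v. perm_val t' v z = x" by blast
    next
      fix v show "\<exists>u. perm_val t' u z = perm_val t' w (perm_val t' v z)"
        by (rule exI[of _ "w @ v"]) (simp add: perm_val_append t')
    qed
    then show ?thesis by (simp add: r'_def)
  qed
  have rr: "r c = c" if "c \<in> r ` X" for c
    using that r r_val by (metis (no_types, lifting) imageE)
  have rr': "r' c = c" if "c \<in> r' ` Y" for c
    using that r' r'_val by (metis (no_types, lifting) imageE)
  have CX: "r ` X \<subseteq> X" "r' ` Y \<subseteq> Y" using r r' by auto
  have C: "countable (r ` X)" "infinite (r ` X \<times> (UNIV :: nat set))"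
    "countable (r' ` Y)" "infinite (r' ` Y \<times> (UNIV :: nat set))"
    using X Y by (auto simp: finite_cartesian_product_iff)
  obtain f where f: "bij_betw f (r ` X \<times> (UNIV :: nat set)) (UNIV :: nat set)"
    using countableE_infinite[of "r ` X \<times> (UNIV :: nat set)"] C by auto
  obtain g where g: "bij_betw g (UNIV :: nat set) (r' ` Y \<times> (UNIV :: nat set))"
    using countable_infiniteE'[of "r' ` Y \<times> (UNIV :: nat set)"] C by auto
  define \<beta> where "\<beta> = g \<circ> f"
  have \<beta>: "bij_betw \<beta> (r ` X \<times> (UNIV :: nat set)) (r' ` Y \<times> (UNIV :: nat set))"
    unfolding \<beta>_def by (rule bij_betw_trans[OF f g])
  have \<beta>_in: "fst (\<beta> (r x, k)) \<in> r' ` Y" if "x \<in> X" for x k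
    using bij_betwE[OF \<beta>] that by (metis SigmaI UNIV_I imageI mem_Times_iff)
  have same: "perm_val t u c = perm_val t v c \<longleftrightarrow> perm_val t' u c' = perm_val t' v c'"
    if "c \<in> X" "c' \<in> Y" for u v c c'
    unfolding perm_val_eq_iff[of t u c v, OF t] perm_val_eq_iff[of t' u c' v, OF t']
    using that by (rule stab)
  define wd where "wd x = (SOME w. perm_val t w (r x) = x)" for x
  have wd: "perm_val t (wd x) (r x) = x" if "x \<in> X" for x
    unfolding wd_def using conjunct2[OF r[OF that]]
    by (rule someI_ex[of "\<lambda>w. perm_val t w (r x) = x"])
  define \<theta> where "\<theta> = (\<lambda>(x, k). apfst (perm_val t' (wd x)) (\<beta> (r x, k)))"
  have \<theta>_val: "\<theta> (perm_val t w c, k) = apfst (perm_val t' w) (\<beta> (c, k))" if "c \<in> r ` X" for w c k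
  proof -
    have c: "c \<in> X" "r c = c" using that CX(1) rr[OF that] by blast+
    have inX: "perm_val t w c \<in> X"
      by (rule perm_val_invariant) (use c t X in auto)
    have "perm_val t (wd (perm_val t w c)) c = perm_val t w c"
      using wd[OF inX] c by (simp add: r_val)
    moreover have "fst (\<beta> (c, k)) \<in> Y"
      using \<beta>_in[OF c(1), of k] CX c by auto
    ultimately have "perm_val t' (wd (perm_val t w c)) (fst (\<beta> (c, k))) = perm_val t' w (fst (\<beta> (c, k)))"
      using same c by blast
    then show ?thesis
      using c by (simp add: \<theta>_def r_val prod_eq_iff)
  qed
  show ?thesis
  proof (intro exI[of _ \<theta>] conjI allI ballI)
    show "bij_betw \<theta> (X \<times> (UNIV :: nat set)) (Y \<times> (UNIV :: nat set))"
      unfolding bij_betw_def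
    proof (intro conjI inj_onI)
      fix p p' assume p: "p \<in> X \<times> (UNIV :: nat set)" and p': "p' \<in> X \<times> (UNIV :: nat set)"
        and eq: "\<theta> p = \<theta> p'"
      obtain x k x' k' where pp: "p = (x, k)" "p' = (x', k')" by (cases p, cases p')
      have x: "x \<in> X" "x' \<in> X" using p p' pp by auto
      have *: "r' (fst (\<theta> (x, k))) = fst (\<beta> (r x, k))" if "x \<in> X" for x k
        using rr'[OF \<beta>_in[OF that]] by (simp add: \<theta>_def r'_val)
      have "fst (\<beta> (r x, k)) = fst (\<beta> (r x', k'))"
        using *[OF x(1), of k] *[OF x(2), of k'] eq pp by simp
      moreover have "snd (\<beta> (r x, k)) = snd (\<beta> (r x', k'))"
        using arg_cong[OF eq, of snd] by (simp add: pp \<theta>_def)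
      ultimately have "\<beta> (r x, k) = \<beta> (r x', k')" by (simp add: prod_eq_iff)
      then have rk: "r x = r x'" "k = k'"
        using \<beta> x by (auto simp: bij_betw_def inj_on_def)
      have "perm_val t' (wd x) (fst (\<beta> (r x, k))) = perm_val t' (wd x') (fst (\<beta> (r x, k)))"
        using arg_cong[OF eq, of fst] by (simp add: pp \<theta>_def rk)
      moreover have "fst (\<beta> (r x, k)) \<in> Y" "r x \<in> X" using \<beta>_in[OF x(1)] CX x by auto
      ultimately have "perm_val t (wd x) (r x) = perm_val t (wd x') (r x)" using same by blast
      then have "x = x'" using wd[OF x(1)] wd[OF x(2)] rk(1) by metis
      then show "p = p'" using rk(2) pp by simp
    next
      show "\<theta> ` (X \<times> UNIV) = Y \<times> UNIV"
      proof safe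
        fix x k y l assume "x \<in> X" "(y, l) = \<theta> (x, k)"
        then have "y = perm_val t' (wd x) (fst (\<beta> (r x, k)))" by (simp add: \<theta>_def prod_eq_iff)
        moreover have "fst (\<beta> (r x, k)) \<in> Y" using \<beta>_in[OF \<open>x \<in> X\<close>] CX(2) by blast
        ultimately show "y \<in> Y"
          using perm_val_invariant[of t' Y, OF t' Y(1)] by blast
      next
        fix y and l :: nat assume y: "y \<in> Y"
        then obtain w where w: "perm_val t' w (r' y) = y" using r' by blast
        have "(r' y, l) \<in> \<beta> ` (r ` X \<times> UNIV)" using \<beta> y by (simp add: bij_betw_def)
        then obtain p where p: "(r' y, l) = \<beta> p" "p \<in> r ` X \<times> UNIV" by (rule imageE)
        define c k where "c = fst p" and "k = snd p"
        have c: "c \<in> r ` X" "\<beta> (c, k) = (r' y, l)"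
          using p by (simp_all add: c_def k_def mem_Times_iff)
        have "\<theta> (perm_val t w c, k) = (y, l)"
          using \<theta>_val[OF c(1)] c w by simp
        moreover have "perm_val t w c \<in> X"
          by (rule perm_val_invariant) (use c CX t X in auto)
        ultimately show "(y, l) \<in> \<theta> ` (X \<times> UNIV)"
          by (metis SigmaI UNIV_I imageI)
      qed simp
    qed
  next
    fix i and p :: "'x \<times> nat" assume "p \<in> X \<times> UNIV"
    then obtain x k where p: "p = (x, k)" "x \<in> X" by auto
    have "r x \<in> r ` X" using p by simp
    from \<theta>_val[OF this, of "(i, True) # wd x" k] \<theta>_val[OF this, of "wd x" k]
    show "\<theta> (apfst (t i) p) = apfst (t' i) (\<theta> p)"
      using wd[OF p(2)] unfolding p(1) by (simp add: prod_eq_iff)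
  qed
qed

lemma countable_group_acts_freely:
  fixes G (structure)
  assumes "group G" "countable (carrier G)"
  obtains \<alpha> :: "'g \<Rightarrow> nat \<Rightarrow> nat"
  where "\<alpha> \<in> hom G perm_group" "\<And>g n. g \<in> carrier G \<Longrightarrow> \<alpha> g n = n \<Longrightarrow> g = \<one>\<^bsub>G\<^esub>"
proof -
  interpret group G by fact
  let ?X = "carrier G \<times> (UNIV :: nat set)"
  have "countable ?X" "infinite ?X"
    using assms one_closed by (auto simp: finite_cartesian_product_iff)
  then obtain h where h: "bij_betw h ?X (UNIV :: nat set)" by (rule countableE_infinite)
  define k where "k = inv_into ?X h"
  have hk: "h (k n) = n" for n using h by (simp add: k_def bij_betw_inv_into_right)
  have kh: "k (h p) = p" if "p \<in> ?X" for p using h that by (simp add: k_def bij_betw_inv_into_left)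
  have k: "fst (k n) \<in> carrier G" for n
    using bij_betw_inv_into[OF h] by (metis UNIV_I bij_betwE k_def mem_Times_iff)
  define \<alpha> where "\<alpha> g n = h (g \<otimes> fst (k n), snd (k n))" for g n
  have mult: "\<alpha> (g \<otimes> g') = \<alpha> g \<circ> \<alpha> g'" if "g \<in> carrier G" "g' \<in> carrier G" for g g'
    using that k by (auto simp: \<alpha>_def kh m_assoc)
  have one: "\<alpha> \<one> = id"
    using k hk by (auto simp: \<alpha>_def)
  have "bij (\<alpha> g)" if "g \<in> carrier G" for g
    using mult[of g "inv g"] mult[of "inv g" g] that one by (auto intro: o_bij[of "\<alpha> (inv g)"])
  then have "\<alpha> \<in> hom G perm_group"
    using mult by (auto simp: hom_def)
  moreover have "g = \<one>" if "g \<in> carrier G" "\<alpha> g n = n" for g n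
  proof -
    have "(g \<otimes> fst (k n), snd (k n)) = k n"
      using that k kh[of "(g \<otimes> fst (k n), snd (k n))"] by (simp add: \<alpha>_def)
    then have "g \<otimes> fst (k n) = fst (k n)" by (metis fst_conv)
    then show ?thesis using that k r_cancel_one by blast
  qed
  ultimately show thesis by (rule that)
qed

lemma free_action_conj:
  fixes \<alpha> :: "'g \<Rightarrow> nat \<Rightarrow> nat" and \<phi> \<psi> :: "'i \<Rightarrow> 'g"
  assumes "group G" "\<alpha> \<in> hom G perm_group" "\<And>g n. g \<in> carrier G \<Longrightarrow> \<alpha> g n = n \<Longrightarrow> g = \<one>\<^bsub>G\<^esub>"
    and \<phi>: "\<And>i. \<phi> i \<in> carrier G" and \<psi>: "\<And>i. \<psi> i \<in> carrier G"
    and iff: "\<And>w. word_val G \<phi> w = \<one>\<^bsub>G\<^esub> \<longleftrightarrow> word_val G \<psi> w = \<one>\<^bsub>G\<^esub>"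
  obtains x :: "nat \<times> nat \<Rightarrow> nat \<times> nat"
  where "bij x" "\<And>i. apfst (\<alpha> (\<phi> i)) \<circ> x = x \<circ> apfst (\<alpha> (\<psi> i))"
proof -
  interpret G: group G by fact
  interpret \<alpha>: group_hom G perm_group \<alpha>
    by (simp add: assms group_hom_axioms_def group_hom_def group_perm_group)
  have bij: "bij (\<alpha> g)" if "g \<in> carrier G" for g using \<alpha>.hom_closed[OF that] by simp
  have val: "perm_val (\<lambda>i. \<alpha> (f i)) w n = n \<longleftrightarrow> word_val G f w = \<one>\<^bsub>G\<^esub>"
    if "\<And>i. f i \<in> carrier G" for f :: "'i \<Rightarrow> 'g" and w n
  proof -
    have hom: "perm_val (\<lambda>i. \<alpha> (f i)) w = \<alpha> (word_val G f w)"
      using G.word_val_hom[OF group_perm_group assms(2), of f w] that by simp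
    have "word_val G f w = \<one>\<^bsub>G\<^esub>" if "\<alpha> (word_val G f w) n = n"
      by (rule assms(3)[OF _ that]) (simp add: \<open>\<And>i. f i \<in> carrier G\<close>)
    moreover have "\<alpha> \<one>\<^bsub>G\<^esub> = id" using \<alpha>.hom_one by simp
    ultimately show ?thesis unfolding hom by auto
  qed
  have "\<exists>\<theta>. bij_betw \<theta> ((UNIV :: nat set) \<times> (UNIV :: nat set)) ((UNIV :: nat set) \<times> (UNIV :: nat set)) \<and>
      (\<forall>i. \<forall>p\<in>UNIV \<times> UNIV. \<theta> (apfst (\<alpha> (\<psi> i)) p) = apfst (\<alpha> (\<phi> i)) (\<theta> p))"
    by (rule equivariant_bij[of "\<lambda>i. \<alpha> (\<psi> i)" "\<lambda>i. \<alpha> (\<phi> i)" UNIV UNIV])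
      (simp_all add: \<phi> \<psi> bij bij_is_surj val iff)
  then obtain \<theta> :: "nat \<times> nat \<Rightarrow> nat \<times> nat"
    where "bij \<theta>" "\<And>i p. \<theta> (apfst (\<alpha> (\<psi> i)) p) = apfst (\<alpha> (\<phi> i)) (\<theta> p)"
    by auto
  then show thesis
    by (intro that[of \<theta>]) (simp_all add: fun_eq_iff del: apfst_conv)
qed

lemma apfst_hom: "apfst \<in> hom perm_group (perm_group :: ('x \<times> 'y \<Rightarrow> 'x \<times> 'y) monoid)"
proof (rule homI)
  fix f :: "'x \<Rightarrow> 'x" assume "f \<in> carrier perm_group"
  then have "bij f" by simp
  then have "bij (apfst f :: 'x \<times> 'y \<Rightarrow> _)"
    by (intro o_bij[of "apfst (inv_into UNIV f)"]) (auto simp: fun_eq_iff bij_is_inj bij_is_surj surj_f_inv_f)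
  then show "apfst f \<in> carrier (perm_group :: ('x \<times> 'y \<Rightarrow> 'x \<times> 'y) monoid)" by simp
qed (auto simp: fun_eq_iff)

text \<open>For isomorphic subgroups given by generators \<open>\<phi>\<close> and \<open>\<psi>\<close>, the element \<open>x\<close> plays the role of
  the stable letter of the HNN extension.\<close>

lemma HNN_embedding:
  fixes \<phi> \<psi> :: "'i \<Rightarrow> 'g"
  assumes "group G" "countable (carrier G)"
    and "\<And>i. \<phi> i \<in> carrier G" "\<And>i. \<psi> i \<in> carrier G"
    and "\<And>w. word_val G \<phi> w = \<one>\<^bsub>G\<^esub> \<longleftrightarrow> word_val G \<psi> w = \<one>\<^bsub>G\<^esub>"
  obtains \<zeta> and x :: "nat \<times> nat \<Rightarrow> nat \<times> nat"
  where "\<zeta> \<in> mon G perm_group" "bij x" "\<And>i. \<zeta> (\<phi> i) \<circ> x = x \<circ> \<zeta> (\<psi> i)"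
proof -
  interpret G: group G by fact
  obtain \<alpha> :: "'g \<Rightarrow> nat \<Rightarrow> nat" where \<alpha>: "\<alpha> \<in> hom G perm_group"
    "\<And>g n. g \<in> carrier G \<Longrightarrow> \<alpha> g n = n \<Longrightarrow> g = \<one>\<^bsub>G\<^esub>"
    using countable_group_acts_freely[OF assms(1,2)] by metis
  obtain x :: "nat \<times> nat \<Rightarrow> nat \<times> nat"
    where x: "bij x" "\<And>i. apfst (\<alpha> (\<phi> i)) \<circ> x = x \<circ> apfst (\<alpha> (\<psi> i))"
    using free_action_conj[OF assms(1) \<alpha> assms(3-5)] by metis
  have hom: "(\<lambda>g. apfst (\<alpha> g)) \<in> hom G (perm_group :: (nat \<times> nat \<Rightarrow> _) monoid)"
    using hom_compose[OF \<alpha>(1) apfst_hom] by (simp add: o_def)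
  interpret h: group_hom G "perm_group :: (nat \<times> nat \<Rightarrow> _) monoid" "\<lambda>g. apfst (\<alpha> g)"
    by (simp add: hom group_hom_axioms_def group_hom_def group_perm_group assms)
  have "inj_on (\<lambda>g. apfst (\<alpha> g) :: nat \<times> nat \<Rightarrow> _) (carrier G)"
    unfolding h.inj_on_one_iff using \<alpha>(2) by (auto simp: fun_eq_iff)
  then show thesis
    using that[of "\<lambda>g. apfst (\<alpha> g)"] hom x by (auto simp: mon_def)
qed

section \<open>Ping-pong\<close>

definition reduced :: "'a word \<Rightarrow> bool"
  where "reduced = successively (\<lambda>(a, b) (a', b'). \<not> (a = a' \<and> b \<noteq> b'))"

lemma free_eq_reduced: "\<exists>v. (w, v) \<in> free_eq UNIV \<and> reduced v"
proof (induction w)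
  case Nil
  then show ?case by (intro exI[of _ "[]"]) (auto simp: reduced_def intro: free_eq.refl)
next
  case (Cons c w)
  then obtain v where v: "(w, v) \<in> free_eq UNIV" "reduced v" by blast
  obtain a b where c: "c = (a, b)" by (cases c)
  have cv: "(c # w, c # v) \<in> free_eq UNIV"
    using free_eq_append_left[OF v(1), of "[c]"] by simp
  show ?case
  proof (cases "\<exists>v'. v = (a, \<not> b) # v'")
    case True
    then obtain v' where v': "v = (a, \<not> b) # v'" by blast
    have "(c # v, v') \<in> free_eq UNIV"
      using free_eq.cancel[of "[]" UNIV v' a b] by (simp add: c v')
    moreover have "reduced v'" using v(2) by (auto simp: reduced_def v' successively_Cons)
    ultimately show ?thesis using cv free_eq.trans by blast
  next
    case False
    then have "reduced (c # v)"
      using v(2) by (cases v) (auto simp: reduced_def c)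
    then show ?thesis using cv by blast
  qed
qed

lemma ping_pong:
  fixes p :: "bool \<Rightarrow> 'x \<Rightarrow> 'x" and S :: "bool \<Rightarrow> 'x set"
  assumes bij: "\<And>c. bij (p c)" and disj: "S True \<inter> S False = {}" and ne: "\<And>c. S c \<noteq> {}"
    and pos: "\<And>c n x. n > 0 \<Longrightarrow> x \<in> S c \<Longrightarrow> (p c ^^ n) x \<in> S (\<not> c)"
    and neg: "\<And>c n x. n > 0 \<Longrightarrow> x \<in> S c \<Longrightarrow> (inv_into UNIV (p c) ^^ n) x \<in> S (\<not> c)"
    and id: "perm_val p w = id"
  shows "(w, []) \<in> free_eq UNIV"
proof -
  define q where "q c b = (if b then p c else inv_into UNIV (p c))" for c b
  have q: "(q c b ^^ n) x \<in> S (\<not> c)" if "n > 0" "x \<in> S c" for c b n x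
    using pos[OF that] neg[OF that] by (simp add: q_def)
  have val_Cons: "perm_val p ((c, b) # v) z = q c b (perm_val p v z)" for c b v z
    by (simp add: q_def bij)
  have key: "\<exists>m>0. \<exists>z\<in>S c. perm_val p ((c, b) # v) z0 = (q c b ^^ m) z"
    if "reduced ((c, b) # v)" "last ((c, b) # v) = (d, e)" "z0 \<in> S d" for c b v d e z0
    using that
  proof (induction v arbitrary: c b)
    case Nil
    then show ?case by (intro exI[of _ 1]) (auto simp: q_def bij)
  next
    case (Cons l v)
    obtain c' b' where l: "l = (c', b')" by (cases l)
    have "reduced ((c', b') # v)" "last ((c', b') # v) = (d, e)"
      using Cons.prems by (auto simp: reduced_def l successively_Cons)
    from Cons.IH[OF this Cons.prems(3)] obtain m z
      where m: "m > 0" "z \<in> S c'" "perm_val p (l # v) z0 = (q c' b' ^^ m) z"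
      by (auto simp: l)
    show ?case
    proof (cases "c = c'")
      case True
      then have "b = b'" using Cons.prems(1) by (auto simp: reduced_def l)
      then have "perm_val p ((c, b) # l # v) z0 = (q c b ^^ Suc m) z"
        using m(3) True unfolding val_Cons[of c b "l # v"] by simp
      then show ?thesis using m(2) True by blast
    next
      case False
      then have "perm_val p (l # v) z0 \<in> S c" using q[OF m(1,2), of b'] m(3) by (cases c) auto
      then show ?thesis
        unfolding val_Cons[of c b "l # v"] by (intro exI[of _ 1]) auto
    qed
  qed
  obtain v where v: "(w, v) \<in> free_eq UNIV" "reduced v" using free_eq_reduced by blast
  have v_id: "perm_val p v = id"
    using perm_group.word_val_free_eq[of p, OF _ v(1)] id bij by simp
  have "v = []"
  proof (rule ccontr)
    assume "v \<noteq> []"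
    then obtain c b v' where v': "v = (c, b) # v'" by (cases v) auto
    obtain d e where l: "last v = (d, e)" by (cases "last v")
    obtain u where u: "u \<in> S d" using ne by blast
    have "reduced (v @ [(d, e)])"
      using v(2) l by (auto simp: reduced_def successively_append_iff)
    then have r2: "reduced ((c, b) # v' @ [(d, e)])" by (simp add: v')
    obtain m z where "m > 0" "z \<in> S c" "perm_val p v u = (q c b ^^ m) z"
      using key[of c b v' d e u] v(2) l u by (auto simp: v')
    then have "u \<in> S (\<not> c)" using q v_id by (metis id_apply)
    then have d: "d = (\<not> c)" using u disj by (cases c; cases d) auto
    obtain m z where "m > 0" "z \<in> S c" "perm_val p (v @ [(d, e)]) u = (q c b ^^ m) z"
      using key[of c b "v' @ [(d, e)]" d e u] r2 u by (auto simp: v')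
    then have "perm_val p (v @ [(d, e)]) u \<in> S (\<not> c)" using q by metis
    moreover have "perm_val p (v @ [(d, e)]) u = q d e u"
      using v_id by (simp add: perm_val_append bij q_def)
    moreover have "q d e u \<in> S (\<not> d)" using q[of 1 u d e] u by simp
    ultimately show False using d disj by (cases c) auto
  qed
  then show ?thesis using v(1) by simp
qed

section \<open>The key model\<close>

lemma free_permutations:
  obtains g :: "'a :: countable \<Rightarrow> nat \<Rightarrow> nat"
  where "\<And>a. bij (g a)" "\<And>w z. perm_val g w z = z \<Longrightarrow> (w, []) \<in> free_eq UNIV"
proof -
  let ?F = "free_group (UNIV :: 'a set)"
  interpret F: group ?F by (rule group_free_group)
  obtain \<alpha> :: "'a word set \<Rightarrow> nat \<Rightarrow> nat" where \<alpha>: "\<alpha> \<in> hom ?F perm_group"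
    "\<And>x n. x \<in> carrier ?F \<Longrightarrow> \<alpha> x n = n \<Longrightarrow> x = \<one>\<^bsub>?F\<^esub>"
    using countable_group_acts_freely[OF group_free_group countable_free_group] by metis
  have el: "free_elem UNIV w \<in> carrier ?F" for w by (simp add: carrier_free_group)
  have val: "perm_val (\<lambda>a. \<alpha> (free_elem UNIV (letter a))) w = \<alpha> (free_elem UNIV w)" for w
    using F.word_val_hom[OF group_perm_group \<alpha>(1), of "\<lambda>a. free_elem UNIV (letter a)" w]
    by (simp add: el word_val_free_group)
  show thesis
  proof (rule that)
    show "bij (\<alpha> (free_elem UNIV (letter a)))" for a
      using hom_in_carrier[OF \<alpha>(1) el] by simp
    show "(w, []) \<in> free_eq UNIV" if "perm_val (\<lambda>a. \<alpha> (free_elem UNIV (letter a))) w z = z" for w z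
      using \<alpha>(2)[OF el, of w z] that free_elem_eqD[of UNIV w "[]"]
      by (simp add: val one_free_group)
  qed
qed

lemma free_eq_subst_word:
  assumes "(u, v) \<in> free_eq UNIV"
  shows "(subst_word \<pi> u, subst_word \<pi> v) \<in> free_eq UNIV"
proof -
  let ?F = "free_group UNIV"
  interpret F: group ?F by (rule group_free_group)
  have el: "free_elem UNIV w \<in> carrier ?F" for w by (simp add: carrier_free_group)
  have val: "free_elem UNIV (subst_word \<pi> w) = word_val ?F (\<lambda>a. free_elem UNIV (\<pi> a)) w" for w
    using F.word_val_subst_word[of "\<lambda>a. free_elem UNIV (letter a)" \<pi> w, OF el]
    by (simp add: word_val_free_group)
  have "free_elem UNIV (subst_word \<pi> u) = free_elem UNIV (subst_word \<pi> v)"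
    unfolding val by (rule F.word_val_free_eq[OF _ assms]) (rule el)
  then show ?thesis by (rule free_elem_eqD) simp
qed

text \<open>The differences \<open>g\<^sub>n\<^sub>+\<^sub>1\<^sub>+\<^sub>j g\<^sub>n\<inverse>\<close> of free generators are again free: substituting the letter \<open>j\<close> for
  \<open>g\<^sub>n\<^sub>+\<^sub>1\<^sub>+\<^sub>j\<close> and the empty word for the other generators recovers the word.\<close>

lemma free_differences:
  fixes g :: "int \<Rightarrow> 'x \<Rightarrow> 'x" and n :: int
  assumes bij: "\<And>i. bij (g i)" and free: "\<And>w z. perm_val g w z = z \<Longrightarrow> (w, []) \<in> free_eq UNIV"
    and fixed: "perm_val (\<lambda>j. g (n + 1 + int j) \<circ> inv_into UNIV (g n)) w z = z"
  shows "(w, []) \<in> free_eq UNIV"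
proof -
  define \<sigma> where "\<sigma> j = [(n + 1 + int j, True), (n, False)]" for j
  define \<pi> where "\<pi> m = (if m > n then letter (nat (m - n - 1)) else [])" for m
  have "perm_val g (\<sigma> j) = g (n + 1 + int j) \<circ> inv_into UNIV (g n)" for j
    by (simp add: \<sigma>_def bij)
  then have "perm_val g (subst_word \<sigma> w) z = z"
    using perm_group.word_val_subst_word[of g \<sigma> w] fixed bij by simp
  then have "(subst_word \<pi> (subst_word \<sigma> w), subst_word \<pi> []) \<in> free_eq UNIV"
    using free by (intro free_eq_subst_word) blast
  moreover have "subst_word \<pi> (subst_word \<sigma> w) = w"
    by (induction w) (auto simp: \<sigma>_def \<pi>_def letter_def)
  ultimately show ?thesis by simp
qed

lemma map_prod_bij: "bij f \<Longrightarrow> bij g \<Longrightarrow> bij (map_prod f g)"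
  by (simp add: bij_def prod.inj_map map_prod_surj)

lemma inv_map_prod:
  assumes "bij f" "bij g"
  shows "inv_into UNIV (map_prod f g) = map_prod (inv_into UNIV f) (inv_into UNIV g)"
  using assms
  by (intro inv_unique_comp)
    (auto simp: fun_eq_iff bij_is_inj bij_is_surj surj_f_inv_f)

lemma perm_val_map_prod:
  assumes "\<And>i. bij (f i)" "\<And>i. bij (h i)"
  shows "perm_val (\<lambda>i. map_prod (f i) (h i)) w = map_prod (perm_val f w) (perm_val h w)"
proof (induction w)
  case (Cons c w)
  then show ?case
    using assms by (cases c) (auto simp: map_prod_bij inv_map_prod)
qed (simp add: prod.map_id0)

lemma funpow_map_prod:
  fixes f :: "'a \<Rightarrow> 'a" and h :: "'b \<Rightarrow> 'b"
  shows "map_prod f h ^^ n = map_prod (f ^^ n) (h ^^ n)"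
  by (induction n) (simp_all add: fun_eq_iff)

lemma funpow_inv_fixed_point_free:
  fixes e :: "'a \<Rightarrow> 'a"
  assumes "bij e" "\<And>z. (e ^^ n) z \<noteq> z"
  shows "(inv_into UNIV e ^^ n) z \<noteq> z"
proof
  assume "(inv_into UNIV e ^^ n) z = z"
  then have "(e ^^ n) z = z"
    using bij_inv_eq_iff[OF bij_fn[OF assms(1), of n], of z z] inv_fn[OF assms(1), of n] by simp
  then show False using assms(2) by blast
qed

text \<open>
  The permutations \<open>b\<close> and \<open>y\<close> move the level (the \<open>int\<close> coordinate) down and up by one, and \<open>b\<^sup>i y\<^sup>i\<close>
  acts on level \<open>n\<close> as \<open>g\<^sub>n\<^sub>+\<^sub>i g\<^sub>n\<inverse>\<close> for free generators \<open>g\<^sub>n\<close>. The bijection \<open>\<theta>\<close> carries this set to one on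
  which \<open>b\<^sup>i y\<^sup>i\<close> acts through \<open>s\<^sub>i\<close> on the coordinate moved by \<open>e\<close>. It sends level \<open>0\<close> to the
  complement of \<open>B\<close> and the other levels to \<open>B\<close>, where \<open>B\<close> is disjoint from its images under the
  nontrivial powers of \<open>e\<close>; hence \<open>b\<close> and \<open>e\<close> play ping-pong with level \<open>0\<close> and the other levels.
\<close>

lemma key_model:
  fixes e :: "'l :: countable \<Rightarrow> 'l" and s :: "nat \<Rightarrow> 'l \<Rightarrow> 'l"
  assumes e: "bij e" and s: "\<And>i. bij (s i)" and free_e: "\<And>n z. n > 0 \<Longrightarrow> (e ^^ n) z \<noteq> z"
  obtains \<iota> :: "('l \<Rightarrow> 'l) \<Rightarrow> (nat \<times> int) \<times> nat \<Rightarrow> (nat \<times> int) \<times> nat" and b y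
  where "\<iota> \<in> mon perm_group perm_group" "bij b" "bij y"
    and "\<And>i f f'. i \<ge> 1 \<Longrightarrow> f \<circ> s i = s i \<circ> f' \<Longrightarrow> \<iota> f \<circ> (b ^^ i \<circ> y ^^ i) = (b ^^ i \<circ> y ^^ i) \<circ> \<iota> f'"
    and "\<And>w. perm_val (\<lambda>c. if c then b else \<iota> e) w = id \<Longrightarrow> (w, []) \<in> free_eq UNIV"
proof -
  obtain g :: "int \<Rightarrow> nat \<Rightarrow> nat" where g: "\<And>n. bij (g n)"
    and free_g: "\<And>w z. perm_val g w z = z \<Longrightarrow> (w, []) \<in> free_eq UNIV"
    using free_permutations by metis
  define \<tau> where "\<tau> n j = g (n + 1 + int j) \<circ> inv_into UNIV (g n)" for n j
  have \<tau>: "bij (\<tau> n j)" for n j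
    by (simp add: \<tau>_def bij_comp g bij_imp_bij_inv)
  have free_\<tau>: "(w, []) \<in> free_eq UNIV" if "perm_val (\<tau> n) w z = z" for n w z
  proof (rule free_differences[where n = n and z = z and g = g, OF g free_g])
    show "perm_val (\<lambda>j. g (n + 1 + int j) \<circ> inv_into UNIV (g n)) w z = z"
      using that by (simp add: \<tau>_def[abs_def])
  qed
  have \<tau>_iff: "perm_val (\<tau> n) w z = z \<longleftrightarrow> (w, []) \<in> free_eq UNIV" for n w z
    by (rule perm_val_free_eq_iff[OF \<tau> free_\<tau>])

  define t :: "nat \<Rightarrow> nat \<times> int \<Rightarrow> nat \<times> int" where "t j = (\<lambda>(p, n). (\<tau> n j p, n))" for j
  have inv_t: "inv_into UNIV (t j) = (\<lambda>(p, n). (inv_into UNIV (\<tau> n j) p, n))" and bij_t: "bij (t j)" for j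
  proof -
    let ?u = "\<lambda>(p, n). (inv_into UNIV (\<tau> n j) p, n)"
    have "t j \<circ> ?u = id" "?u \<circ> t j = id"
      using \<tau> by (auto simp: t_def fun_eq_iff bij_is_inj bij_is_surj surj_f_inv_f)
    then show "inv_into UNIV (t j) = ?u" "bij (t j)"
      by (auto intro: inv_unique_comp o_bij)
  qed
  have val_t: "perm_val t w (p, n) = (perm_val (\<tau> n) w p, n)" for w p n
  proof (induction w)
    case (Cons c w)
    then show ?case
      by (cases c) (simp add: bij_t inv_t \<tau>, simp add: t_def)
  qed simp
  define t' where "t' j = map_prod (s (Suc j)) (\<tau> 0 j)" for j
  have bij_t': "bij (t' j)" for j by (simp add: t'_def map_prod_bij s \<tau>)
  have val_t': "perm_val t' w = map_prod (perm_val (\<lambda>j. s (Suc j)) w) (perm_val (\<tau> 0) w)" for w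
    unfolding t'_def by (rule perm_val_map_prod) (rule s, rule \<tau>)
  have t_iff: "perm_val t w x = x \<longleftrightarrow> (w, []) \<in> free_eq UNIV" for w x
    by (cases x) (simp add: val_t \<tau>_iff)
  have t'_iff: "perm_val t' w x = x \<longleftrightarrow> (w, []) \<in> free_eq UNIV" for w x
  proof (rule perm_val_free_eq_iff[OF bij_t'])
    fix w x assume "perm_val t' w x = x"
    then have "perm_val (\<tau> 0) w (snd x) = snd x" by (metis snd_map_prod val_t')
    then show "(w, []) \<in> free_eq UNIV" by (simp add: \<tau>_iff)
  qed

  define \<mu> :: 'l where "\<mu> = undefined"
  define B where "B = range (\<lambda>w. perm_val t' w (\<mu>, 0))"
  have inv_B: "t' j ` B = B" for j
  proof
    have "t' j (perm_val t' w x) = perm_val t' ((j, True) # w) x" for w x by simp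
    then show "t' j ` B \<subseteq> B" unfolding B_def by blast
    have "perm_val t' w x = t' j (perm_val t' ((j, False) # w) x)" for w x
      using bij_t'[of j] by (simp add: bij_is_surj surj_f_inv_f)
    then show "B \<subseteq> t' j ` B" unfolding B_def by blast
  qed
  then have inv_mB: "t' j ` (- B) = - B" for j
    using bij_image_Compl_eq[OF bij_t', of j B] by simp
  have shift: "map_prod f id x \<notin> B" if "x \<in> B" and f: "\<And>z. f z \<noteq> z" for f x
  proof
    assume "map_prod f id x \<in> B"
    then obtain v where v: "map_prod f id x = perm_val t' v (\<mu>, 0)" by (auto simp: B_def)
    from that obtain w where w: "x = perm_val t' w (\<mu>, 0)" by (auto simp: B_def)
    have "perm_val (\<tau> 0) w 0 = perm_val (\<tau> 0) v 0"
      using arg_cong[OF v, of snd] by (simp add: w val_t')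
    then have "perm_val (\<tau> 0) (inv_word v @ w) 0 = 0"
      using perm_val_eq_iff[of "\<tau> 0" w 0 v, OF \<tau>] by simp
    then have "(inv_word v @ w, []) \<in> free_eq UNIV" by (simp add: \<tau>_iff)
    then have "perm_val (\<lambda>j. s (Suc j)) (inv_word v @ w) = id"
      using perm_group.word_val_free_eq[of "\<lambda>j. s (Suc j)" "inv_word v @ w" "[]" UNIV] s by simp
    then have "perm_val (\<lambda>j. s (Suc j)) w \<mu> = perm_val (\<lambda>j. s (Suc j)) v \<mu>"
      using perm_val_eq_iff[of "\<lambda>j. s (Suc j)" w \<mu> v, OF s] by simp
    then have "f (perm_val (\<lambda>j. s (Suc j)) v \<mu>) = perm_val (\<lambda>j. s (Suc j)) v \<mu>"
      using arg_cong[OF v, of fst] by (simp add: w val_t')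
    then show False using f by blast
  qed
  have \<mu>_B: "(\<mu>, 0) \<in> B" unfolding B_def by (rule range_eqI[of _ _ "[]"]) simp
  have mB_ne: "- B \<noteq> {}"
    using shift[OF \<mu>_B, of e] free_e[of 1] by auto

  define L where "L = {x :: nat \<times> int. snd x = 0}"
  have t_L: "t j ` L = L" "t j ` (- L) = - L" for j
  proof -
    have iff: "t j x \<in> L \<longleftrightarrow> x \<in> L" for x by (cases x) (simp add: L_def t_def)
    show "t j ` L = L"
    proof (intro equalityI subsetI)
      fix x assume "x \<in> t j ` L"
      then show "x \<in> L" by (elim imageE) (simp add: iff)
    next
      fix x assume x: "x \<in> L"
      obtain z where z: "x = t j z" using surjD[OF bij_is_surj[OF bij_t[of j]]] by blast
      then have "z \<in> L" using x iff by simp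
      then show "x \<in> t j ` L" using z by (intro image_eqI)
    qed
    then show "t j ` (- L) = - L"
      using bij_image_Compl_eq[OF bij_t, of j L] by simp
  qed
  have "(0, 0) \<in> L" "(0, 1) \<in> - L" by (simp_all add: L_def)
  then have L_ne: "L \<noteq> {}" "- L \<noteq> {}" by blast+
  have "\<exists>\<theta>. bij_betw \<theta> (L \<times> (UNIV :: nat set)) ((- B) \<times> (UNIV :: nat set)) \<and>
      (\<forall>j. \<forall>p\<in>L \<times> UNIV. \<theta> (apfst (t j) p) = apfst (t' j) (\<theta> p))"
    by (rule equivariant_bij[of t t' L "- B"])
      (simp_all add: bij_t bij_t' t_L inv_mB L_ne mB_ne t_iff t'_iff)
  then obtain \<theta>0 where \<theta>0: "bij_betw \<theta>0 (L \<times> (UNIV :: nat set)) ((- B) \<times> (UNIV :: nat set))"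
      "\<And>j p. p \<in> L \<times> UNIV \<Longrightarrow> \<theta>0 (apfst (t j) p) = apfst (t' j) (\<theta>0 p)" by blast
  have "\<exists>\<theta>. bij_betw \<theta> ((- L) \<times> (UNIV :: nat set)) (B \<times> (UNIV :: nat set)) \<and>
      (\<forall>j. \<forall>p\<in>(- L) \<times> UNIV. \<theta> (apfst (t j) p) = apfst (t' j) (\<theta> p))"
    by (rule equivariant_bij[of t t' "- L" B])
      (use \<mu>_B in \<open>auto simp: bij_t bij_t' t_L inv_B L_ne t_iff t'_iff\<close>)
  then obtain \<theta>1 where \<theta>1: "bij_betw \<theta>1 ((- L) \<times> (UNIV :: nat set)) (B \<times> (UNIV :: nat set))"
      "\<And>j p. p \<in> (- L) \<times> UNIV \<Longrightarrow> \<theta>1 (apfst (t j) p) = apfst (t' j) (\<theta>1 p)" by blast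
  define \<theta> where "\<theta> p = (if fst p \<in> L then \<theta>0 p else \<theta>1 p)" for p
  have \<theta>L: "bij_betw \<theta> (L \<times> UNIV) ((- B) \<times> UNIV)"
    using \<theta>0(1) by (rule bij_betw_cong[THEN iffD1, rotated]) (auto simp: \<theta>_def)
  have \<theta>mL: "bij_betw \<theta> ((- L) \<times> UNIV) (B \<times> UNIV)"
    using \<theta>1(1) by (rule bij_betw_cong[THEN iffD1, rotated]) (auto simp: \<theta>_def)
  have "bij_betw \<theta> (L \<times> UNIV \<union> (- L) \<times> UNIV) ((- B) \<times> UNIV \<union> B \<times> UNIV)"
    by (rule bij_betw_combine[OF \<theta>L \<theta>mL]) auto
  moreover have "L \<times> UNIV \<union> (- L) \<times> UNIV = (UNIV :: ((nat \<times> int) \<times> nat) set)"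
    "(- B) \<times> UNIV \<union> B \<times> UNIV = (UNIV :: (('l \<times> nat) \<times> nat) set)" by auto
  ultimately have \<theta>: "bij \<theta>" by simp
  have \<theta>_B: "fst (\<theta> p) \<in> B \<longleftrightarrow> fst p \<notin> L" for p
    using bij_betwE[OF \<theta>L] bij_betwE[OF \<theta>mL]
    by (metis ComplD ComplI UNIV_I mem_Times_iff)
  have \<theta>_t: "\<theta> (apfst (t j) p) = apfst (t' j) (\<theta> p)" for j p
  proof -
    have "t j x \<in> L \<longleftrightarrow> x \<in> L" for x by (cases x) (simp add: L_def t_def)
    then show ?thesis
      using \<theta>0(2)[of p j] \<theta>1(2)[of p j] by (cases p) (auto simp: \<theta>_def)
  qed

  define \<kappa> :: "('l \<Rightarrow> 'l) \<Rightarrow> ('l \<times> nat) \<times> nat \<Rightarrow> ('l \<times> nat) \<times> nat"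
    where "\<kappa> f = apfst (map_prod f id)" for f
  define \<iota> where "\<iota> f = inv_into UNIV \<theta> \<circ> \<kappa> f \<circ> \<theta>" for f
  have \<theta>\<iota>: "\<theta> (\<iota> f p) = \<kappa> f (\<theta> p)" for f p
    using \<theta> by (simp add: \<iota>_def bij_is_surj surj_f_inv_f)
  have \<theta>_inj: "\<theta> p = \<theta> q \<longleftrightarrow> p = q" for p q
    using \<theta> by (simp add: bij_def inj_eq)
  have \<iota>_comp: "\<iota> (f \<circ> f') = \<iota> f \<circ> \<iota> f'" for f f'
  proof
    fix p
    have "\<theta> (\<iota> (f \<circ> f') p) = \<theta> ((\<iota> f \<circ> \<iota> f') p)"
      by (simp add: \<theta>\<iota> \<kappa>_def prod_eq_iff)
    then show "\<iota> (f \<circ> f') p = (\<iota> f \<circ> \<iota> f') p" by (simp only: \<theta>_inj)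
  qed
  have \<iota>_id: "\<iota> id = id"
  proof
    fix p
    have "\<theta> (\<iota> id p) = \<theta> (id p)"
      by (simp add: \<theta>\<iota> \<kappa>_def prod_eq_iff)
    then show "\<iota> id p = id p" by (simp only: \<theta>_inj)
  qed
  have \<iota>_inv: "\<iota> f \<circ> \<iota> (inv_into UNIV f) = id" "\<iota> (inv_into UNIV f) \<circ> \<iota> f = id"
    if "bij f" for f
  proof -
    have "f \<circ> inv_into UNIV f = id" "inv_into UNIV f \<circ> f = id"
      using that by (simp_all add: bij_is_inj bij_is_surj surj_iff[symmetric])
    then show "\<iota> f \<circ> \<iota> (inv_into UNIV f) = id" "\<iota> (inv_into UNIV f) \<circ> \<iota> f = id"
      by (simp_all add: \<iota>_id flip: \<iota>_comp)
  qed
  have \<iota>_bij: "bij (\<iota> f)" if "bij f" for f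
    using \<iota>_inv[OF that] by (intro o_bij)
  have inv_\<iota>: "inv_into UNIV (\<iota> f) = \<iota> (inv_into UNIV f)" if "bij f" for f
    by (rule inv_unique_comp) (rule \<iota>_inv[OF that])+
  have \<iota>_pow: "\<iota> f ^^ n = \<iota> (f ^^ n)" for f n
    by (induction n) (simp_all only: funpow.simps \<iota>_id \<iota>_comp)
  have mon: "\<iota> \<in> mon perm_group perm_group"
  proof -
    have "f = f'" if "\<iota> f = \<iota> f'" for f f'
    proof
      fix z
      have "\<kappa> f (\<theta> p) = \<kappa> f' (\<theta> p)" for p using that by (metis \<theta>\<iota>)
      then have "\<kappa> f ((z, 0), 0) = \<kappa> f' ((z, 0), 0)"
        using \<theta> by (metis bij_is_surj surjD)
      then show "f z = f' z" by (simp add: \<kappa>_def)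
    qed
    then show ?thesis
      by (auto simp: mon_def hom_def \<iota>_bij \<iota>_comp intro!: inj_onI)
  qed

  define b :: "(nat \<times> int) \<times> nat \<Rightarrow> (nat \<times> int) \<times> nat"
    where "b = (\<lambda>((p, n), k). ((p, n - 1), k))"
  define b' :: "(nat \<times> int) \<times> nat \<Rightarrow> (nat \<times> int) \<times> nat"
    where "b' = (\<lambda>((p, n), k). ((p, n + 1), k))"
  define y :: "(nat \<times> int) \<times> nat \<Rightarrow> (nat \<times> int) \<times> nat"
    where "y = (\<lambda>((p, n), k). ((g (n + 1) (inv_into UNIV (g n) p), n + 1), k))"
  define y' :: "(nat \<times> int) \<times> nat \<Rightarrow> (nat \<times> int) \<times> nat"
    where "y' = (\<lambda>((p, n), k). ((g (n - 1) (inv_into UNIV (g n) p), n - 1), k))"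
  have gg: "inv_into UNIV (g n) (g n p) = p" "g n (inv_into UNIV (g n) p) = p" for n p
    using g[of n] by (simp_all add: bij_is_inj bij_is_surj surj_f_inv_f)
  have bb': "b \<circ> b' = id" "b' \<circ> b = id" by (auto simp: b_def b'_def)
  then have bij_b: "bij b" and inv_b: "inv_into UNIV b = b'"
    by (auto intro: o_bij inv_unique_comp)
  have "y \<circ> y' = id" "y' \<circ> y = id" by (auto simp: y_def y'_def gg)
  then have bij_y: "bij y" by (auto intro: o_bij)
  have b_pow: "(b ^^ i) ((p, n), k) = ((p, n - int i), k)" for i p n k
    by (induction i) (auto simp: b_def)
  have b'_pow: "(b' ^^ i) ((p, n), k) = ((p, n + int i), k)" for i p n k
    by (induction i) (auto simp: b'_def)
  have y_pow: "(y ^^ i) ((p, n), k) = ((g (n + int i) (inv_into UNIV (g n) p), n + int i), k)" for i p n k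
    by (induction i) (auto simp: y_def gg add.assoc add.commute[of 1])
  have by_pow: "b ^^ Suc j \<circ> y ^^ Suc j = apfst (t j)" for j
    by (auto simp: fun_eq_iff y_pow b_pow t_def \<tau>_def add.assoc simp del: funpow.simps)

  show thesis
  proof (rule that[OF mon bij_b bij_y])
    fix i :: nat and f f' :: "'l \<Rightarrow> 'l" assume "i \<ge> 1" and ff': "f \<circ> s i = s i \<circ> f'"
    then obtain j where j: "i = Suc j" by (cases i) auto
    show "\<iota> f \<circ> (b ^^ i \<circ> y ^^ i) = (b ^^ i \<circ> y ^^ i) \<circ> \<iota> f'"
      unfolding j by_pow
    proof
      fix p
      have "f (s i z) = s i (f' z)" for z using fun_cong[OF ff', of z] by simp
      then have "\<theta> ((\<iota> f \<circ> apfst (t j)) p) = \<theta> ((apfst (t j) \<circ> \<iota> f') p)"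
        by (simp add: \<theta>\<iota> \<theta>_t \<kappa>_def prod_eq_iff t'_def j)
      then show "(\<iota> f \<circ> apfst (t j)) p = (apfst (t j) \<circ> \<iota> f') p" by (simp only: \<theta>_inj)
    qed
  next
    define S where "S c = {p :: (nat \<times> int) \<times> nat. c \<longleftrightarrow> fst p \<in> L}" for c
    have e_S: "\<iota> f p \<in> S True" if "p \<in> S False" "\<And>z. f z \<noteq> z" for f p
    proof -
      have "fst (\<theta> p) \<in> B" using that by (simp add: \<theta>_B S_def)
      then have "fst (\<theta> (\<iota> f p)) \<notin> B" using shift[OF _ that(2)] by (simp add: \<theta>\<iota> \<kappa>_def)
      then show ?thesis by (simp add: \<theta>_B S_def)
    qed
    have e_inv: "(inv_into UNIV e ^^ n) z \<noteq> z" if "n > 0" for n z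
      by (rule funpow_inv_fixed_point_free[OF e free_e[OF that]])
    fix w assume w: "perm_val (\<lambda>c. if c then b else \<iota> e) w = id"
    show "(w, []) \<in> free_eq UNIV"
    proof (rule ping_pong[of "\<lambda>c. if c then b else \<iota> e" S])
      show "bij (if c then b else \<iota> e)" for c by (simp add: bij_b \<iota>_bij e)
      show "S True \<inter> S False = {}" by (auto simp: S_def)
      show "S c \<noteq> {}" for c using L_ne by (cases c) (auto simp: S_def)
      show "((if c then b else \<iota> e) ^^ n) p \<in> S (\<not> c)" if "n > 0" "p \<in> S c" for c n p
        using that e_S[of p "e ^^ n"] free_e[of n]
        by (cases c; cases p; cases "fst p") (auto simp: S_def L_def b_pow \<iota>_pow)
      show "(inv_into UNIV (if c then b else \<iota> e) ^^ n) p \<in> S (\<not> c)" if "n > 0" "p \<in> S c" for c n p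
        using that e_S[of p "inv_into UNIV e ^^ n"] e_inv[of n]
        by (cases c; cases p; cases "fst p") (auto simp: S_def L_def b'_pow inv_b inv_\<iota> e \<iota>_pow)
      show "perm_val (\<lambda>c. if c then b else \<iota> e) w = id" by (rule w)
    qed
  qed
qed

section \<open>The embedding\<close>

lemma (in group) word_val_single_letter:
  "\<exists>k :: int. \<forall>u\<in>carrier G. word_val G (\<lambda>_ :: unit. u) w = u [^] k"
proof (induction w)
  case Nil
  then show ?case by (intro exI[of _ 0]) simp
next
  case (Cons c w)
  then obtain k :: int where k: "\<And>u. u \<in> carrier G \<Longrightarrow> word_val G (\<lambda>_. u) w = u [^] k" by blast
  have "word_val G (\<lambda>_. u) (c # w) = u [^] (if snd c then 1 + k else - 1 + k)"
    if "u \<in> carrier G" for u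
  proof -
    have "u [^] (1 + k) = u \<otimes> u [^] k" "u [^] (- 1 + k) = inv u \<otimes> u [^] k"
      unfolding int_pow_mult[OF that] int_pow_neg[OF that] using that by simp_all
    then show ?thesis using that k by (cases c) simp
  qed
  then show ?case by blast
qed

lemma torsion_free_word_val_iff:
  assumes "group G" "torsion_free G"
    and "u \<in> carrier G" "u \<noteq> \<one>\<^bsub>G\<^esub>" "v \<in> carrier G" "v \<noteq> \<one>\<^bsub>G\<^esub>"
  shows "word_val G (\<lambda>_ :: unit. u) w = \<one>\<^bsub>G\<^esub> \<longleftrightarrow> word_val G (\<lambda>_. v) w = \<one>\<^bsub>G\<^esub>"
proof -
  interpret group G by fact
  have zero: "z [^]\<^bsub>G\<^esub> k = \<one>\<^bsub>G\<^esub> \<longleftrightarrow> k = 0" if "z \<in> carrier G" "z \<noteq> \<one>\<^bsub>G\<^esub>" for z and k :: int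
  proof -
    have pos: "z [^]\<^bsub>G\<^esub> n \<noteq> \<one>\<^bsub>G\<^esub>" if "n > 0" for n :: nat
      using assms(2) \<open>z \<in> carrier G\<close> \<open>z \<noteq> \<one>\<^bsub>G\<^esub>\<close> that by (simp add: torsion_free_def)
    show ?thesis
    proof (cases k rule: int_cases2)
      case (nonneg n)
      then show ?thesis using pos[of n] by (auto simp: int_pow_int)
    next
      case (nonpos n)
      then show ?thesis using pos[of n] \<open>z \<in> carrier G\<close> by (auto simp: int_pow_neg_int)
    qed
  qed
  obtain k :: int where "\<And>z. z \<in> carrier G \<Longrightarrow> word_val G (\<lambda>_ :: unit. z) w = z [^]\<^bsub>G\<^esub> k"
    using word_val_single_letter by blast
  then show ?thesis using assms zero by simp
qed

lemma perm_val_a_bar: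
  fixes f :: "xy \<Rightarrow> 'x \<Rightarrow> 'x"
  assumes bij: "\<And>c. bij (f c)"
    and x: "f X_gen = x" and y: "f Y_gen = y"
    and yx: "y \<circ> x = x \<circ> b" and bx: "b \<circ> x = x \<circ> e"
    and e: "e \<circ> (b ^^ i \<circ> y ^^ i) = (b ^^ i \<circ> y ^^ i) \<circ> a"
  shows "perm_val f (a_bar i) = x \<circ> a \<circ> inv_into UNIV x"
proof -
  define v where "v = x \<circ> x \<circ> (b ^^ i \<circ> y ^^ i)"
  define w where "w = pow_word (x_word @ pow_word y_word i) 2 @ inv_word x_word"
  have bx': "bij x" using bij[of X_gen] x by simp
  have yx': "y (x p) = x (b p)" and bx'': "b (x p) = x (e p)" for p
    using fun_cong[OF yx, of p] fun_cong[OF bx, of p] by simp_all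
  have e': "e ((b ^^ i) ((y ^^ i) p)) = (b ^^ i) ((y ^^ i) (a p))" for p
    using fun_cong[OF e, of p] by simp
  have ypow: "(y ^^ n) (x p) = x ((b ^^ n) p)" for n p
    by (induction n) (simp_all add: yx')
  have val: "perm_val f (u @ u') = perm_val f u \<circ> perm_val f u'" for u u'
    using perm_group.word_val_append[of f u u'] bij by simp
  have xyi: "perm_val f (x_word @ pow_word y_word i) = x \<circ> y ^^ i"
    unfolding val using perm_group.word_val_letter[of f] perm_group.word_val_pow_word[of f] bij
    by (simp add: x y pow_perm_group)
  then have "perm_val f w = (x \<circ> y ^^ i) ^^ 2 \<circ> inv_into UNIV x"
    unfolding w_def val
    using xyi perm_group.word_val_letter[of f] perm_group.word_val_pow_word[of f] bij bx'
      perm_val_inv_word[of f]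
    by (simp add: x pow_perm_group)
  also have "(x \<circ> y ^^ i) ^^ 2 = v"
    by (simp add: fun_eq_iff v_def numeral_2_eq_2 ypow)
  finally have w: "perm_val f w = v \<circ> inv_into UNIV x" .
  have conj: "perm_val f (a_bar i) = inv_into UNIV (perm_val f w) \<circ> (y \<circ> perm_val f w)"
    unfolding a_bar_def conj_word_def w_def[symmetric] val
    using perm_group.word_val_letter[of f Y_gen] bij y by (simp add: perm_val_inv_word)
  have "y \<circ> v = v \<circ> a"
    by (simp add: fun_eq_iff v_def yx' bx'' e')
  then have "y \<circ> perm_val f w = perm_val f w \<circ> (x \<circ> a \<circ> inv_into UNIV x)"
    unfolding w using bx' by (auto simp: fun_eq_iff bij_is_inj)
  then show ?thesis
    using bij_perm_val[of f w, OF bij] unfolding conj by (simp add: fun_eq_iff bij_is_inj)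
qed

lemma map_prod_eq_id: "map_prod f h = id \<longleftrightarrow> f = id \<and> h = id"
  by (auto simp: fun_eq_iff)

lemma universal_embedding:
  fixes a :: "nat \<Rightarrow> 'g"
  assumes "group G" "countable (carrier G)" "torsion_free G"
    and a: "\<And>i. a i \<in> carrier G" "\<And>i. a i \<noteq> \<one>\<^bsub>G\<^esub>"
  obtains f :: "xy \<Rightarrow> nat \<times> nat \<Rightarrow> nat \<times> nat" and \<zeta>
  where "\<And>c. bij (f c)" "\<zeta> \<in> mon G perm_group" "\<And>i. i \<ge> 1 \<Longrightarrow> perm_val f (a_bar i) = \<zeta> (a i)"
proof -
  interpret G: group G by fact
  obtain \<alpha> :: "'g \<Rightarrow> nat \<Rightarrow> nat" where \<alpha>: "\<alpha> \<in> hom G perm_group"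
    and \<alpha>_free: "\<And>g n. g \<in> carrier G \<Longrightarrow> \<alpha> g n = n \<Longrightarrow> g = \<one>\<^bsub>G\<^esub>"
    using countable_group_acts_freely[OF assms(1,2)] by metis
  define \<rho> :: "'g \<Rightarrow> nat \<times> nat \<Rightarrow> nat \<times> nat" where "\<rho> g = apfst (\<alpha> g)" for g
  have \<rho>_hom: "\<rho> \<in> hom G perm_group"
    using hom_compose[OF \<alpha> apfst_hom] by (simp add: \<rho>_def[abs_def] o_def)
  interpret \<rho>: group_hom G perm_group \<rho>
    by (simp add: \<rho>_hom group_hom_axioms_def group_hom_def group_perm_group assms(1))
  have \<rho>_bij: "bij (\<rho> g)" if "g \<in> carrier G" for g using \<rho>.hom_closed[OF that] by simp
  have \<rho>_free: "g = \<one>\<^bsub>G\<^esub>" if "g \<in> carrier G" "\<rho> g p = p" for g p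
    using that \<alpha>_free by (cases p) (auto simp: \<rho>_def)
  have "\<exists>s. bij s \<and> \<rho> (a 0) \<circ> s = s \<circ> \<rho> (a i)" for i
  proof -
    obtain x :: "nat \<times> nat \<Rightarrow> nat \<times> nat"
      where "bij x" "\<And>j :: unit. apfst (\<alpha> (a 0)) \<circ> x = x \<circ> apfst (\<alpha> (a i))"
      using free_action_conj[of G \<alpha> "\<lambda>_ :: unit. a 0" "\<lambda>_. a i"] assms(1) \<alpha> \<alpha>_free a
        torsion_free_word_val_iff[OF assms(1,3) a(1,2)[of 0] a(1,2)[of i]] by metis
    then show ?thesis by (auto simp: \<rho>_def)
  qed
  then obtain s where s: "\<And>i. bij (s i)" "\<And>i. \<rho> (a 0) \<circ> s i = s i \<circ> \<rho> (a i)" by metis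
  have free: "(\<rho> (a 0) ^^ n) z \<noteq> z" if "n > 0" for n z
  proof
    assume "(\<rho> (a 0) ^^ n) z = z"
    then have "\<rho> (a 0 [^]\<^bsub>G\<^esub> n) z = z"
      using \<rho>.hom_nat_pow[of "a 0" n] a by (simp add: pow_perm_group)
    then have "a 0 [^]\<^bsub>G\<^esub> n = \<one>\<^bsub>G\<^esub>" by (rule \<rho>_free[rotated]) (simp add: a)
    then show False using assms(3) a that by (simp add: torsion_free_def)
  qed
  obtain \<iota> :: "(nat \<times> nat \<Rightarrow> nat \<times> nat) \<Rightarrow> (nat \<times> int) \<times> nat \<Rightarrow> (nat \<times> int) \<times> nat" and b2 y2
    where \<iota>: "\<iota> \<in> mon perm_group perm_group" and bij2: "bij b2" "bij y2"
    and rel: "\<And>i f f'. i \<ge> 1 \<Longrightarrow> f \<circ> s i = s i \<circ> f' \<Longrightarrow> \<iota> f \<circ> (b2 ^^ i \<circ> y2 ^^ i) = (b2 ^^ i \<circ> y2 ^^ i) \<circ> \<iota> f'"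
    and free2: "\<And>w. perm_val (\<lambda>c. if c then b2 else \<iota> (\<rho> (a 0))) w = id \<Longrightarrow> (w, []) \<in> free_eq UNIV"
    using key_model[of "\<rho> (a 0)" s, OF \<rho>_bij[OF a(1)] s(1) free] by metis
  obtain q :: "bool \<Rightarrow> nat \<Rightarrow> nat" where q: "\<And>c. bij (q c)"
    "\<And>w z. perm_val q w z = z \<Longrightarrow> (w, []) \<in> free_eq UNIV"
    using free_permutations by metis
  define b where "b = map_prod b2 (q False)"
  define y where "y = map_prod y2 (q True)"
  define \<epsilon> where "\<epsilon> g = map_prod (\<iota> (\<rho> g)) (id :: nat \<Rightarrow> nat)" for g
  have \<iota>_bij: "bij (\<iota> f)" if "bij f" for f
    using hom_in_carrier[of \<iota> perm_group perm_group f] \<iota> that by (simp add: mon_def)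
  have \<iota>_comp: "\<iota> (f \<circ> f') = \<iota> f \<circ> \<iota> f'" if "bij f" "bij f'" for f f'
    using hom_mult[of \<iota> perm_group perm_group f f'] \<iota> that by (simp add: mon_def)
  have bij: "bij b" "bij y" by (simp_all add: b_def y_def map_prod_bij bij2 q)
  have \<epsilon>_bij: "bij (\<epsilon> g)" if "g \<in> carrier G" for g
    by (simp add: \<epsilon>_def map_prod_bij \<iota>_bij \<rho>_bij that)
  have \<epsilon>_mult: "\<epsilon> (g \<otimes>\<^bsub>G\<^esub> g') = \<epsilon> g \<circ> \<epsilon> g'" if "g \<in> carrier G" "g' \<in> carrier G" for g g'
    using \<rho>.hom_mult[OF that] that by (simp add: \<epsilon>_def \<iota>_comp \<rho>_bij map_prod.comp)
  have \<epsilon>_inj: "inj_on \<epsilon> (carrier G)"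
  proof (rule inj_onI)
    fix g g' assume g: "g \<in> carrier G" "g' \<in> carrier G" and "\<epsilon> g = \<epsilon> g'"
    then have "\<iota> (\<rho> g) = \<iota> (\<rho> g')" by (auto simp: \<epsilon>_def fun_eq_iff)
    then have "\<rho> g = \<rho> g'"
      using \<iota> g \<rho>_bij by (auto simp: mon_def inj_on_def)
    moreover have "inj_on \<rho> (carrier G)"
      unfolding \<rho>.inj_on_one_iff using \<rho>_free by (metis eq_id_iff perm_group_simps(3))
    ultimately show "g = g'" using g by (meson inj_onD)
  qed
  have rel': "\<epsilon> (a 0) \<circ> (b ^^ i \<circ> y ^^ i) = (b ^^ i \<circ> y ^^ i) \<circ> \<epsilon> (a i)" if "i \<ge> 1" for i
    using rel[OF that s(2)] by (simp add: \<epsilon>_def b_def y_def funpow_map_prod map_prod.comp)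

  define \<phi> where "\<phi> c = (if c then y else b)" for c
  define \<psi> where "\<psi> c = (if c then b else \<epsilon> (a 0))" for c
  define S where "S = insert b (insert y (\<epsilon> ` carrier G))"
  have S: "S \<subseteq> carrier perm_group" "countable S"
    using assms(2) by (auto simp: S_def bij \<epsilon>_bij)
  define M where "M = generate perm_group S"
  have SM: "S \<subseteq> M" unfolding M_def by (auto intro: generate.incl)
  have M: "subgroup M perm_group" unfolding M_def by (rule perm_group.generate_is_subgroup[OF S(1)])
  have MG: "group (perm_group\<lparr>carrier := M\<rparr>)" by (rule subgroup.subgroup_is_group[OF M group_perm_group])
  have M_count: "countable (carrier (perm_group\<lparr>carrier := M\<rparr>))"
    using perm_group.countable_generate[OF S(2,1)] by (simp add: M_def)
  have \<phi>M: "\<phi> c \<in> M" and \<psi>M: "\<psi> c \<in> M" for c using SM a by (auto simp: \<phi>_def \<psi>_def S_def)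
  have \<phi>_eq: "\<phi> = (\<lambda>c. map_prod (if c then y2 else b2) (q c))"
    by (auto simp: \<phi>_def b_def y_def fun_eq_iff)
  have \<psi>_eq: "\<psi> = (\<lambda>c. map_prod (if c then b2 else \<iota> (\<rho> (a 0))) (if c then q False else id))"
    by (auto simp: \<psi>_def b_def \<epsilon>_def fun_eq_iff)
  have \<phi>_bij: "bij (\<phi> c)" and \<psi>_bij: "bij (\<psi> c)" for c
    by (simp_all add: \<phi>_def \<psi>_def bij \<epsilon>_bij a)
  have "perm_val \<phi> w = id \<longleftrightarrow> (w, []) \<in> free_eq UNIV" for w
  proof
    assume "perm_val \<phi> w = id"
    then have "map_prod (perm_val (\<lambda>c. if c then y2 else b2) w) (perm_val q w) = id"
      unfolding \<phi>_eq by (subst (asm) perm_val_map_prod) (simp_all add: bij2 q(1))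
    then show "(w, []) \<in> free_eq UNIV" using q(2) by (simp add: map_prod_eq_id)
  qed (use perm_group.word_val_free_eq[of \<phi> w "[]" UNIV] \<phi>_bij in simp)
  moreover have "perm_val \<psi> w = id \<longleftrightarrow> (w, []) \<in> free_eq UNIV" for w
  proof
    assume "perm_val \<psi> w = id"
    then have "map_prod (perm_val (\<lambda>c. if c then b2 else \<iota> (\<rho> (a 0))) w)
        (perm_val (\<lambda>c. if c then q False else id) w) = id"
      unfolding \<psi>_eq by (subst (asm) perm_val_map_prod) (simp_all add: bij2 q(1) \<iota>_bij \<rho>_bij a)
    then show "(w, []) \<in> free_eq UNIV" using free2 by (simp add: map_prod_eq_id)
  qed (use perm_group.word_val_free_eq[of \<psi> w "[]" UNIV] \<psi>_bij in simp)
  ultimately have iff: "perm_val \<phi> w = id \<longleftrightarrow> perm_val \<psi> w = id" for w by blast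
  obtain \<zeta> and x :: "nat \<times> nat \<Rightarrow> nat \<times> nat"
    where \<zeta>: "\<zeta> \<in> mon (perm_group\<lparr>carrier := M\<rparr>) perm_group" and x: "bij x"
      "\<And>c. \<zeta> (\<phi> c) \<circ> x = x \<circ> \<zeta> (\<psi> c)"
    using HNN_embedding[of "perm_group\<lparr>carrier := M\<rparr>" \<phi> \<psi>] MG M_count \<phi>M \<psi>M iff
    by (simp add: perm_group.word_val_subgroup[OF M]) blast
  interpret \<zeta>: group_hom "perm_group\<lparr>carrier := M\<rparr>" perm_group \<zeta>
    using \<zeta> MG by (simp add: mon_def group_hom_axioms_def group_hom_def group_perm_group)
  have \<zeta>_comp: "\<zeta> (g \<circ> h) = \<zeta> g \<circ> \<zeta> h" if "g \<in> M" "h \<in> M" for g h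
    using \<zeta>.hom_mult[of g h] that by simp
  have \<zeta>_pow: "\<zeta> (g ^^ n) = \<zeta> g ^^ n" "g ^^ n \<in> M" if "g \<in> M" for g n
    using \<zeta>.hom_nat_pow[of g n] \<zeta>.nat_pow_closed[of g n] that
    by (simp_all add: pow_perm_group flip: perm_group.nat_pow_consistent)
  have M_comp: "g \<circ> h \<in> M" if "g \<in> M" "h \<in> M" for g h
    using subgroup.m_closed[OF M that] by simp
  have bM: "b \<in> M" "y \<in> M" and \<epsilon>M: "\<And>g. g \<in> carrier G \<Longrightarrow> \<epsilon> g \<in> M" using SM by (auto simp: S_def)
  have \<zeta>_bij: "bij (\<zeta> g)" if "g \<in> M" for g using \<zeta>.hom_closed[of g] that by simp

  define f where "f c = (case c of X_gen \<Rightarrow> x | Y_gen \<Rightarrow> \<zeta> y)" for c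
  define \<eta> where "\<eta> g = x \<circ> \<zeta> (\<epsilon> g) \<circ> inv_into UNIV x" for g
  have f_bij: "bij (f c)" for c by (cases c) (simp_all add: f_def x \<zeta>_bij bM)
  show thesis
  proof (rule that[of f \<eta>])
    show "bij (f c)" for c by (rule f_bij)
    show "perm_val f (a_bar i) = \<eta> (a i)" if "i \<ge> 1" for i
      unfolding \<eta>_def
    proof (rule perm_val_a_bar)
      show "bij (f c)" for c by (rule f_bij)
      show "f X_gen = x" "f Y_gen = \<zeta> y" by (simp_all add: f_def)
      show "\<zeta> y \<circ> x = x \<circ> \<zeta> b" using x(2)[of True] by (simp add: \<phi>_def \<psi>_def)
      show "\<zeta> b \<circ> x = x \<circ> \<zeta> (\<epsilon> (a 0))" using x(2)[of False] by (simp add: \<phi>_def \<psi>_def)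
      have "\<zeta> (\<epsilon> (a 0) \<circ> (b ^^ i \<circ> y ^^ i)) = \<zeta> ((b ^^ i \<circ> y ^^ i) \<circ> \<epsilon> (a i))"
        by (simp only: rel'[OF that])
      then show "\<zeta> (\<epsilon> (a 0)) \<circ> (\<zeta> b ^^ i \<circ> \<zeta> y ^^ i) = (\<zeta> b ^^ i \<circ> \<zeta> y ^^ i) \<circ> \<zeta> (\<epsilon> (a i))"
        by (simp only: \<zeta>_comp M_comp \<zeta>_pow bM \<epsilon>M a)
    qed
    have xx: "inv_into UNIV x (x p) = p" "x (inv_into UNIV x p) = p" for p
      using x(1) by (simp_all add: bij_is_inj bij_is_surj surj_f_inv_f)
    have "\<eta> g \<in> carrier perm_group" if "g \<in> carrier G" for g
      using that by (auto simp: \<eta>_def x bij_imp_bij_inv \<zeta>_bij \<epsilon>M intro!: bij_comp)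
    moreover have "\<eta> (g \<otimes>\<^bsub>G\<^esub> h) = \<eta> g \<circ> \<eta> h" if "g \<in> carrier G" "h \<in> carrier G" for g h
      using that by (simp add: \<eta>_def fun_eq_iff \<epsilon>_mult \<zeta>_comp \<epsilon>M xx)
    moreover have "inj_on \<eta> (carrier G)"
    proof (rule inj_onI)
      fix g h assume g: "g \<in> carrier G" "h \<in> carrier G" and eq: "\<eta> g = \<eta> h"
      have "\<zeta> (\<epsilon> g) p = \<zeta> (\<epsilon> h) p" for p
        using arg_cong[OF fun_cong[OF eq, of "x p"], of "inv_into UNIV x"] by (simp add: \<eta>_def xx)
      then have "\<zeta> (\<epsilon> g) = \<zeta> (\<epsilon> h)" by (rule ext)
      then have "\<epsilon> g = \<epsilon> h"
        using \<zeta> \<epsilon>M g by (auto simp: mon_def inj_on_def)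
      then show "g = h" using \<epsilon>_inj g by (meson inj_onD)
    qed
    ultimately show "\<eta> \<in> mon G perm_group" by (simp add: mon_def hom_def Pi_def)
  qed
qed

theorem theorem3p2:
  fixes I J :: "nat set"
    and r :: "nat \<Rightarrow> nat word"
  defines "R \<equiv> r ` J"
    and "R'' \<equiv> (\<lambda>s. subst_word a_bar (r s)) ` J"
  defines "G \<equiv> presented_group I R"
    and "T \<equiv> presented_group UNIV R''"
  assumes "list_indices I"
    and "list_indices J"
    and "\<And>s. s \<in> J \<Longrightarrow> r s \<in> words I"
    and "torsion_free G"
    and "\<And>i. i \<in> I \<Longrightarrow> pres_elem I R (letter i) = \<one>\<^bsub>G\<^esub> \<Longrightarrow> carrier G = {\<one>\<^bsub>G\<^esub>}"
  shows "\<exists>\<gamma>\<in>mon G T. \<forall>i\<in>I. \<gamma> (pres_elem I R (letter i)) = pres_elem UNIV R'' (a_bar i)"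
proof -
  have R: "R \<subseteq> words I" using assms(7) by (auto simp: R_def)
  have R'': "R'' \<subseteq> words UNIV" by simp
  have R''_iff: "R'' = subst_word a_bar ` R" by (simp add: R_def R''_def image_image)
  have I: "i \<ge> 1" if "i \<in> I" for i
    using assms(5) that by (auto simp: list_indices_def)
  interpret G: group G unfolding G_def by (rule group_presented_group[OF R])
  interpret T: group T unfolding T_def by (rule group_presented_group[OF R''])
  have T_val: "word_val T (\<lambda>i. pres_elem UNIV R'' (a_bar i)) w = pres_elem UNIV R'' (subst_word a_bar w)" for w
    unfolding T_def by (rule word_val_presented_group[OF R'', of w UNIV]) simp_all
  have T_closed: "pres_elem UNIV R'' w \<in> carrier T" for w
    unfolding T_def by (rule pres_elem_closed[OF R'']) simp
  have "word_val T (\<lambda>i. pres_elem UNIV R'' (a_bar i)) w = \<one>\<^bsub>T\<^esub>" if "w \<in> R" for w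
    unfolding T_val unfolding T_def
    by (rule pres_elem_relator[OF R'']) (use that in \<open>simp add: R''_iff\<close>)
  then obtain \<gamma> where \<gamma>: "\<gamma> \<in> hom G T"
    "\<And>w. w \<in> words I \<Longrightarrow> \<gamma> (pres_elem I R w) = pres_elem UNIV R'' (subst_word a_bar w)"
    using presented_group_hom[OF R T.is_group, of "\<lambda>i. pres_elem UNIV R'' (a_bar i)"] T_closed
    unfolding G_def T_val by metis
  interpret \<gamma>: group_hom G T \<gamma>
    using \<gamma> by (simp add: group_hom_def group_hom_axioms_def G.is_group T.is_group)
  have letter: "letter i \<in> words I" if "i \<in> I" for i using that by (simp add: letter_def)
  have "inj_on \<gamma> (carrier G)"
  proof (cases "carrier G = {\<one>\<^bsub>G\<^esub>}")
    case True
    then show ?thesis by simp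
  next
    case False
    then obtain h where h: "h \<in> carrier G" "h \<noteq> \<one>\<^bsub>G\<^esub>" using G.one_closed by blast
    define a where "a i = (if i \<in> I then pres_elem I R (letter i) else h)" for i
    have a: "a i \<in> carrier G" "a i \<noteq> \<one>\<^bsub>G\<^esub>" for i
      using h assms(9)[of i] False pres_elem_closed[OF R letter] by (auto simp: a_def G_def)
    have "countable (carrier G)"
      unfolding G_def carrier_presented_group[OF R] by simp
    then obtain f :: "xy \<Rightarrow> nat \<times> nat \<Rightarrow> nat \<times> nat" and \<zeta> where f: "\<And>c. bij (f c)"
      and \<zeta>: "\<zeta> \<in> mon G perm_group" and f_a: "\<And>i. i \<ge> 1 \<Longrightarrow> perm_val f (a_bar i) = \<zeta> (a i)"
      using universal_embedding[of G a, OF G.is_group _ assms(8) a] by metis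
    have \<zeta>_hom: "\<zeta> \<in> hom G perm_group" using \<zeta> by (simp add: mon_def)
    interpret \<zeta>: group_hom G perm_group \<zeta>
      using \<zeta>_hom by (simp add: group_hom_def group_hom_axioms_def G.is_group group_perm_group)
    have val: "perm_val f (subst_word a_bar w) = \<zeta> (pres_elem I R w)" if "w \<in> words I" for w
    proof -
      have "perm_val f (subst_word a_bar w) = perm_val (\<lambda>i. perm_val f (a_bar i)) w"
        using f by (intro perm_group.word_val_subst_word) simp
      also have "\<dots> = perm_val (\<lambda>i. \<zeta> (a i)) w"
        by (rule perm_group.word_val_cong[OF that]) (rule f_a[OF I])
      also have "\<dots> = \<zeta> (word_val G a w)"
        by (rule G.word_val_hom[OF group_perm_group \<zeta>_hom, symmetric]) (rule a)
      also have "word_val G a w = word_val G (\<lambda>i. pres_elem I R (letter i)) w"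
        by (rule G.word_val_cong[OF that]) (simp add: a_def)
      also have "\<dots> = pres_elem I R (subst_word letter w)"
        unfolding G_def by (rule word_val_presented_group[OF R that letter])
      also have "subst_word letter w = w"
        by (induction w) (auto simp: letter_def)
      finally show ?thesis .
    qed
    have "perm_val f w = \<one>\<^bsub>perm_group\<^esub>" if w: "w \<in> R''" for w
    proof -
      obtain v where v: "v \<in> R" "w = subst_word a_bar v" using w by (auto simp: R''_iff)
      then have "pres_elem I R v = \<one>\<^bsub>G\<^esub>" unfolding G_def by (intro pres_elem_relator[OF R])
      then show ?thesis using val[of v] v R by auto
    qed
    then obtain \<delta> where \<delta>: "\<delta> \<in> hom T perm_group" "\<And>w. \<delta> (pres_elem UNIV R'' w) = perm_val f w"
      using presented_group_hom[OF R'' group_perm_group, of f] f unfolding T_def by auto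
    have "\<delta> (\<gamma> g) = \<zeta> g" if g: "g \<in> carrier G" for g
    proof -
      obtain w where w: "w \<in> words I" "g = pres_elem I R w"
        using g unfolding G_def carrier_presented_group[OF R] by blast
      then show ?thesis by (simp add: \<gamma>(2) \<delta>(2) val)
    qed
    moreover have "inj_on \<zeta> (carrier G)" using \<zeta> by (simp add: mon_def)
    ultimately have "inj_on (\<delta> \<circ> \<gamma>) (carrier G)" by (simp add: inj_on_def)
    then show ?thesis by (rule inj_on_imageI2)
  qed
  then have "\<gamma> \<in> mon G T" using \<gamma>(1) by (simp add: mon_def)
  moreover have "\<gamma> (pres_elem I R (letter i)) = pres_elem UNIV R'' (a_bar i)" if "i \<in> I" for i
    using \<gamma>(2)[OF letter[OF that]] by (simp add: letter_def)
  ultimately show ?thesis by blast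
qed

end
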